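(* Let $n\ge 1$, let $\mathbf a=(a_1,\dots,a_n)\in\mathbb N^n$ with $a_1\neq 0$, and let $\alpha=\operatorname{revcomp}(\mathbf a)$, a composition of $n$. Define the Laurent polynomial $$Q_\alpha(x_0,x_1,\dots,x_n):=\frac1{x_0}+\frac1{x_0^{\,n}}\sum_{\beta\ge_{\mathrm a}\alpha}(-1)^{|\alpha|-\ell(\beta)}\,\pi_{\ell(\beta)}(x_0)\,\mathbf x^{\beta-\mathbf 1},$$ where the sum runs over all compositions $\beta$ of $n$ refining $\alpha$, $\pi_k(x_0)=\prod_{i=1}^k\big((x_0+1)^i-1\big)$, and $\mathbf x^{\beta-\mathbf 1}=\prod_{i=1}^{\ell(\beta)}x_i^{\beta_i-1}$. Then the $f$-polynomial of $\mathrm{Flow}_n(\mathbf a)$ is $$f^{(n)}(\mathbf a;x)=Q_\alpha\big(x,\ (x+1)^1-(x+1),\ (x+1)^2-(x+1),\ \dots,\ (x+1)^n-(x+1)\big).$$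
   Context: $\mathbb N=\{0,1,2,\dots\}$, $[n]=\{1,\dots,n\}$. $K_{n+1}$ is the directed graph on $v_1,\dots,v_{n+1}$ with one edge $(v_i,v_j)$ for each $1\le i<j\le n+1$. For $\mathbf a\in\mathbb N^n$, an $\mathbf a$-flow is a function $f:E(K_{n+1})\to\mathbb R_{\ge0}$ with $\sum_{j>i}f(v_i,v_j)-\sum_{k<i}f(v_k,v_i)=a_i$ for all $i\in[n]$ (so the netflow at $v_{n+1}$ is $-\sum_i a_i$). $\mathrm{Flow}_n(\mathbf a)\subset\mathbb R^{E(K_{n+1})}$ is the polytope of all $\mathbf a$-flows. Its $f$-polynomial is the Laurent polynomial $f^{(n)}(\mathbf a;x)=\sum_{d\ge-1}f_d\,x^d$, where $f_d$ is the number of $d$-dimensional faces (the empty face counts as a face of dimension $-1$, and the polytope itself counts as a face). A composition of $n$ is a tuple $\alpha=(\alpha_1,\dots,\alpha_r)$ of positive integers with sum $|\alpha|=n$; $\ell(\alpha)=r$. For compositions of $n$, $\alpha\le_{\mathrm a}\beta$ means that $\beta$ refines $\alpha$, i.e. $\beta$ is obtained by replacing, in order, each part $\alpha_j$ by a composition of $\alpha_j$ (so $(1,\dots,1)$ is the largest element). For $\mathbf a\in\mathbb N^n$ with $a_1\ne0$, $\operatorname{revcomp}(\mathbf a)$ is the composition of $n$ corresponding to the set $\{n-j : j\in[n-1],\ a_{j+1}\neq0\}\subseteq[n-1]$ under the bijection $\{s_1<\dots<s_k\}\mapsto(s_1,s_2-s_1,\dots,s_k-s_{k-1},n-s_k)$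 (the empty set corresponding to $(n)$). Equivalently: read $\mathbf a$ from right to left, closing a block each time a nonzero entry is read, and record the block sizes; e.g. $\operatorname{revcomp}(1,1,0,0,1,0,1,0)=(2,2,3,1)$. The substitution is a polynomial substitution, so $0^0=1$. *)

theory Defs
  imports "HOL-Analysis.Analysis" "HOL-Computational_Algebra.Formal_Laurent_Series"
begin

text \<open>The vertex \<open>v\<^sub>i\<close> is the number \<open>i\<close>; this is the edge set of \<open>K\<^sub>n\<^sub>+\<^sub>1\<close>.\<close>

definition K_edges :: "nat \<Rightarrow> (nat \<times> nat) set" where
  "K_edges n = {(i, j). 1 \<le> i \<and> i < j \<and> j \<le> n + 1}"

text \<open>Netflow vectors are functions on \<open>nat\<close> of which only the values at \<open>1, \<dots>, n\<close> are used;
  likewise only the values of \<open>f\<close> on \<open>K_edges n\<close> matter.\<close>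

definition is_flow :: "nat \<Rightarrow> (nat \<Rightarrow> nat) \<Rightarrow> (nat \<times> nat \<Rightarrow> real) \<Rightarrow> bool" where
  "is_flow n a f \<longleftrightarrow>
     (\<forall>uv\<in>K_edges n. 0 \<le> f uv) \<and>
     (\<forall>i\<in>{1..n}. (\<Sum>j\<in>{i<..n+1}. f (i, j)) - (\<Sum>k\<in>{1..<i}. f (k, i)) = real (a i))"

text \<open>The space of real functions on the edges is \<open>real ^ 'e\<close>, where the finite type \<open>'e\<close> is
  identified with the edge set by a bijection \<open>e\<close> (required where \<open>Flow\<close> is used): the
  coordinate with index \<open>\<epsilon>\<close> is the value on the edge \<open>e \<epsilon>\<close>.\<close>

definition Flow :: "('e::finite \<Rightarrow> nat \<times> nat) \<Rightarrow> nat \<Rightarrow> (nat \<Rightarrow> nat) \<Rightarrow> (real ^ 'e) set" where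
  "Flow e n a = {(\<chi> \<epsilon>. f (e \<epsilon>)) | f. is_flow n a f}"

definition face_number :: "'a::euclidean_space set \<Rightarrow> int \<Rightarrow> nat" where
  "face_number P d = card {F. F face_of P \<and> aff_dim F = d}"

text \<open>In the library, \<open>{}\<close> is a face of every set and has \<open>aff_dim {} = -1\<close>, and a convex set is a
  face of itself. No face has dimension above \<open>DIM('a)\<close>, so the sum covers all faces.
  Laurent polynomials are represented as formal Laurent series.\<close>

definition f_polynomial :: "'a::euclidean_space set \<Rightarrow> rat fls" where
  "f_polynomial P = (\<Sum>d\<in>{-1..int DIM('a)}. of_nat (face_number P d) * fls_X powi d)"

definition compositions :: "nat \<Rightarrow> nat list set" where
  "compositions n = {\<alpha>. (\<forall>k\<in>set \<alpha>. 0 < k) \<and> sum_list \<alpha> = n}"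

definition refined_by :: "nat list \<Rightarrow> nat list \<Rightarrow> bool" where
  "refined_by \<alpha> \<beta> \<longleftrightarrow>
     (\<exists>\<gamma>s. list_all2 (\<lambda>\<gamma> k. \<gamma> \<in> compositions k) \<gamma>s \<alpha> \<and> \<beta> = concat \<gamma>s)"

definition comp_of_set :: "nat \<Rightarrow> nat set \<Rightarrow> nat list" where
  "comp_of_set n S =
     (let s = sorted_list_of_set S in map2 (\<lambda>t u. t - u) (s @ [n]) (0 # s))"

definition revcomp :: "nat \<Rightarrow> (nat \<Rightarrow> nat) \<Rightarrow> nat list" where
  "revcomp n a = comp_of_set n {n - j | j. j \<in> {1..n-1} \<and> a (j + 1) \<noteq> 0}"

definition pi_poly :: "nat \<Rightarrow> 'a::comm_ring_1 \<Rightarrow> 'a" where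
  "pi_poly k x0 = (\<Prod>i=1..k. ((x0 + 1) ^ i - 1))"

text \<open>The Laurent polynomial \<open>Q\<^sub>\<alpha>(x\<^sub>0, x\<^sub>1, \<dots>, x\<^sub>n)\<close>, given by its values at elements
  of an arbitrary field; \<open>x i\<close> is used for \<open>1 \<le> i \<le> n\<close> only. As \<open>\<beta>\<close> has at most
  \<open>sum_list \<alpha>\<close> parts, all positive, no subtraction of naturals is truncated.\<close>

definition Q_poly :: "nat list \<Rightarrow> 'a::field \<Rightarrow> (nat \<Rightarrow> 'a) \<Rightarrow> 'a" where
  "Q_poly \<alpha> x0 x = 1 / x0 + 1 / x0 ^ sum_list \<alpha> *
     (\<Sum>\<beta> | \<beta> \<in> compositions (sum_list \<alpha>) \<and> refined_by \<alpha> \<beta>.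
        (-1) ^ (sum_list \<alpha> - length \<beta>) * pi_poly (length \<beta>) x0 *
        (\<Prod>i=1..length \<beta>. x i ^ (\<beta> ! (i - 1) - 1)))"

end

theory Submission
  imports Defs
begin

text \<open>A nonempty face of the flow polytope is determined by the set \<open>H\<close> of edges on which its generic
  point is positive. The sets that occur are those in which, for every \<open>i \<le> n\<close>, the vertex \<open>v\<^sub>i\<close>
  has an outgoing edge iff it is fed by \<open>a\<^sub>i\<close> or by an incoming edge, and the dimension of the
  face is the number of edges of \<open>H\<close> minus the number of vertices with outgoing edges. In the sum of
  \<open>x\<^sup>d\<close> over all such \<open>H\<close>, \<open>d\<close> being this dimension, inclusion-exclusion removes the condition
  that active vertices outside the support of \<open>a\<close> have an incoming edge: with \<open>V\<close> the set
  of active vertices, \<open>B \<subseteq> V\<close> a set of vertices without incoming edges and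
  \<open>W = V - B\<close>, every \<open>v \<in> V\<close> freely chooses a nonempty set of targets in
  \<open>W \<union> {v\<^sub>n\<^sub>+\<^sub>1}\<close>, contributing \<open>\<phi>\<^sub>v = ((x + 1)^t - 1) / x\<close> if there are
  \<open>t\<close> targets after \<open>v\<close>. For fixed \<open>W\<close> a vertex outside \<open>W\<close> is either inactive or
  in \<open>B\<close> and contributes \<open>1 - \<phi>\<^sub>v = - ((x + 1)^t - (x + 1)) / x\<close>. The sets \<open>W\<close>, read
  from right to left, are the compositions refining \<open>revcomp a\<close>.\<close>

section \<open>Compositions and their partial sums\<close>

text \<open>The index starts at \<open>1\<close>, so the total is included and \<open>0\<close> is
  not. A composition of a positive \<open>n\<close> thus becomes a set containing \<open>n\<close>,
  whose size is the number of parts.\<close>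

definition psums :: "nat list \<Rightarrow> nat set" where
  "psums \<beta> = {sum_list (take i \<beta>) | i. i \<in> {1..length \<beta>}}"

lemma psums_Nil [simp]: "psums [] = {}"
  by (simp add: psums_def)

lemma psums_append: "psums (\<beta> @ \<gamma>) = psums \<beta> \<union> (+) (sum_list \<beta>) ` psums \<gamma>"
proof -
  have eq: "{1..length (\<beta> @ \<gamma>)} = {1..length \<beta>} \<union> (+) (length \<beta>) ` {1..length \<gamma>}"
    by (simp add: image_add_atLeastAtMost) auto
  have im: "psums \<delta> = (\<lambda>i. sum_list (take i \<delta>)) ` {1..length \<delta>}" for \<delta>
    by (auto simp: psums_def)
  show ?thesis
    unfolding im eq image_Un image_image by (intro arg_cong2[of _ _ _ _ "(\<union>)"] image_cong) auto
qed

lemma psums_singleton [simp]: "psums [b] = {b}"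
  by (force simp: psums_def)

lemma psums_snoc: "psums (\<beta> @ [b]) = insert (sum_list \<beta> + b) (psums \<beta>)"
  by (simp add: psums_append)

lemma finite_psums [simp]: "finite (psums \<beta>)"
  by (induction \<beta> rule: rev_induct) (auto simp: psums_snoc)

lemma psums_bounds:
  assumes "\<forall>k\<in>set \<beta>. 0 < k"
  shows "psums \<beta> \<subseteq> {1..sum_list \<beta>}"
  using assms by (induction \<beta> rule: rev_induct) (force simp: psums_snoc)+

lemma sum_list_in_psums: "\<beta> \<noteq> [] \<Longrightarrow> sum_list \<beta> \<in> psums \<beta>"
  by (cases \<beta> rule: rev_cases) (auto simp: psums_snoc)

lemma sum_list_eq_Max_psums:
  assumes "\<forall>k\<in>set \<beta>. 0 < k"
  shows "sum_list \<beta> = Max (insert 0 (psums \<beta>))"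
proof (cases "\<beta> = []")
  case False
  then show ?thesis
    using psums_bounds[OF assms] sum_list_in_psums[OF False] by (intro Max_eqI[symmetric]) auto
qed auto

lemma card_psums:
  assumes "\<forall>k\<in>set \<beta>. 0 < k"
  shows "card (psums \<beta>) = length \<beta>"
  using assms
proof (induction \<beta> rule: rev_induct)
  case (snoc b \<beta>)
  then have "sum_list \<beta> + b \<notin> psums \<beta>"
    using psums_bounds[of \<beta>] by force
  with snoc show ?case by (simp add: psums_snoc)
qed auto

text \<open>The total is the largest partial sum; deleting it leaves the partial sums of the list
  without its last part, because positive parts keep the earlier sums strictly below the
  total.\<close>

lemma psums_inject:
  assumes "\<forall>k\<in>set \<beta>. 0 < k" "\<forall>k\<in>set \<gamma>. 0 < k" "psums \<beta> = psums \<gamma>"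
  shows "\<beta> = \<gamma>"
  using assms
proof (induction \<beta> arbitrary: \<gamma> rule: rev_induct)
  case Nil
  then show ?case by (cases \<gamma> rule: rev_cases) (auto simp: psums_snoc)
next
  case (snoc b \<beta>)
  then obtain c \<delta> where \<gamma>: "\<gamma> = \<delta> @ [c]"
    by (cases \<gamma> rule: rev_cases) (auto simp: psums_snoc)
  have sum: "sum_list \<beta> + b = sum_list \<delta> + c"
    using sum_list_eq_Max_psums[OF snoc.prems(1)] sum_list_eq_Max_psums[OF snoc.prems(2)]
      snoc.prems(3) by (simp add: \<gamma>)
  have "sum_list \<beta> + b \<notin> psums \<beta>" "sum_list \<delta> + c \<notin> psums \<delta>"
    using psums_bounds[of \<beta>] psums_bounds[of \<delta>] snoc.prems \<gamma> by force+
  with snoc.prems(3) sum have "psums \<beta> = psums \<delta>"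
    unfolding \<gamma> psums_snoc by (metis Diff_insert_absorb)
  then have "\<beta> = \<delta>"
    using snoc.prems \<gamma> by (intro snoc.IH) auto
  with sum show ?case by (simp add: \<gamma>)
qed

lemma psums_surj:
  assumes "finite S" "0 \<notin> S"
  shows "\<exists>\<beta>. (\<forall>k\<in>set \<beta>. 0 < k) \<and> psums \<beta> = S"
  using assms
proof (induction S rule: finite_linorder_max_induct)
  case empty
  show ?case by (intro exI[of _ "[]"]) auto
next
  case (insert m S)
  then obtain \<beta> where \<beta>: "\<forall>k\<in>set \<beta>. 0 < k" "psums \<beta> = S" by auto
  have "sum_list \<beta> < m"
    using sum_list_in_psums[of \<beta>] insert \<beta> by (cases "\<beta> = []") auto
  then show ?case
    using \<beta> by (intro exI[of _ "\<beta> @ [m - sum_list \<beta>]"]) (auto simp: psums_snoc)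
qed

lemma bij_betw_psums:
  assumes "1 \<le> n"
  shows "bij_betw psums (compositions n) {S. S \<subseteq> {1..n} \<and> n \<in> S}"
proof (rule bij_betw_imageI)
  show "inj_on psums (compositions n)"
    by (rule inj_onI) (auto simp: compositions_def intro: psums_inject)
  show "psums ` compositions n = {S. S \<subseteq> {1..n} \<and> n \<in> S}"
  proof (intro equalityI subsetI)
    fix S assume "S \<in> psums ` compositions n"
    then obtain \<beta> where \<beta>: "\<beta> \<in> compositions n" "S = psums \<beta>" by auto
    then have "\<beta> \<noteq> []" using assms by (auto simp: compositions_def)
    then show "S \<in> {S. S \<subseteq> {1..n} \<and> n \<in> S}"
      using \<beta> psums_bounds[of \<beta>] sum_list_in_psums[of \<beta>] by (auto simp: compositions_def)
  next
    fix S assume S: "S \<in> {S. S \<subseteq> {1..n} \<and> n \<in> S}"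
    then have "finite S" "0 \<notin> S" using finite_subset by auto
    from psums_surj[OF this] obtain \<beta> where \<beta>: "\<forall>k\<in>set \<beta>. 0 < k" "psums \<beta> = S" by auto
    have "Max (insert 0 S) = n"
      using S \<open>finite S\<close> by (intro Max_eqI) auto
    then have "sum_list \<beta> = n" using sum_list_eq_Max_psums[OF \<beta>(1)] \<beta>(2) by simp
    with \<beta> show "S \<in> psums ` compositions n" by (auto simp: compositions_def)
  qed
qed

section \<open>Refinement as inclusion of partial sums\<close>

lemma psums_splitE:
  assumes "m \<in> psums \<beta>"
  obtains \<gamma> \<delta> where "\<beta> = \<gamma> @ \<delta>" "sum_list \<gamma> = m"
proof -
  obtain i where "m = sum_list (take i \<beta>)"
    using assms by (auto simp: psums_def)
  then show ?thesis using that[of "take i \<beta>" "drop i \<beta>"] by simp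
qed

text \<open>Each block ends at a partial sum of \<open>\<alpha>\<close>. Positive parts make the
  blocks nonempty, so these ends are partial sums of the concatenation.\<close>

lemma concat_composition_blocks:
  assumes "list_all2 (\<lambda>\<gamma> k. \<gamma> \<in> compositions k) \<gamma>s \<alpha>" "\<forall>k\<in>set \<alpha>. 0 < k"
  shows "sum_list (concat \<gamma>s) = sum_list \<alpha> \<and> psums \<alpha> \<subseteq> psums (concat \<gamma>s)"
  using assms
proof (induction \<alpha> arbitrary: \<gamma>s rule: rev_induct)
  case (snoc k \<alpha>)
  then obtain \<delta>s \<gamma> where \<gamma>s: "\<gamma>s = \<delta>s @ [\<gamma>]" "list_all2 (\<lambda>\<gamma> k. \<gamma> \<in> compositions k) \<delta>s \<alpha>"
      "\<gamma> \<in> compositions k"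
    by (auto simp: list_all2_append2 list_all2_Cons2)
  have "\<gamma> \<noteq> []" using snoc.prems \<gamma>s by (auto simp: compositions_def)
  then have "k \<in> psums \<gamma>" using \<gamma>s sum_list_in_psums[of \<gamma>] by (auto simp: compositions_def)
  with snoc.IH[OF \<gamma>s(2)] snoc.prems \<gamma>s show ?case
    by (auto simp: psums_snoc psums_append compositions_def)
qed auto

text \<open>For the converse, \<open>\<beta>\<close> is cut at the total of \<open>\<alpha>\<close>
  without its last part: the right piece is the block for the last part, and the left piece is
  handled by induction.\<close>

lemma refined_by_iff_psums:
  assumes "\<alpha> \<in> compositions n" "\<beta> \<in> compositions n"
  shows "refined_by \<alpha> \<beta> \<longleftrightarrow> psums \<alpha> \<subseteq> psums \<beta>"
proof
  assume "refined_by \<alpha> \<beta>"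
  then show "psums \<alpha> \<subseteq> psums \<beta>"
    using concat_composition_blocks assms(1) by (auto simp: refined_by_def compositions_def)
next
  assume "psums \<alpha> \<subseteq> psums \<beta>"
  then show "refined_by \<alpha> \<beta>"
    using assms
  proof (induction \<alpha> arbitrary: \<beta> n rule: rev_induct)
    case Nil
    then have "\<beta> = []" by (cases \<beta>) (auto simp: compositions_def)
    then show ?case by (simp add: refined_by_def)
  next
    case (snoc k \<alpha>)
    \<comment> \<open>A cut at \<open>0\<close> is treated separately, as \<open>0\<close> is not
      among the partial sums.\<close>
    obtain \<gamma> \<delta> where \<beta>: "\<beta> = \<gamma> @ \<delta>" "sum_list \<gamma> = sum_list \<alpha>"
    proof (cases "\<alpha> = []")
      case True
      then show ?thesis using that[of "[]" \<beta>] by simp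
    next
      case False
      then have "sum_list \<alpha> \<in> psums \<beta>"
        using sum_list_in_psums[of \<alpha>] snoc.prems(1) by (auto simp: psums_snoc)
      from psums_splitE[OF this] that show ?thesis by metis
    qed
    have pos: "\<forall>k\<in>set \<alpha>. 0 < k" "\<forall>k\<in>set \<gamma>. 0 < k" "\<forall>k\<in>set \<delta>. 0 < k"
      using snoc.prems \<beta> by (auto simp: compositions_def)
    \<comment> \<open>The partial sums of \<open>\<beta>\<close> that involve
      \<open>\<delta>\<close> exceed \<open>sum_list \<gamma>\<close>, so those of
      \<open>\<alpha>\<close> must already occur in \<open>\<gamma>\<close>.\<close>
    have "x \<in> psums \<gamma>" if "x \<in> psums \<alpha>" for x
    proof -
      have "x \<le> sum_list \<gamma>" using that psums_bounds[OF pos(1)] \<beta>(2) by auto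
      moreover have "sum_list \<gamma> < y" if "y \<in> (+) (sum_list \<gamma>) ` psums \<delta>" for y
        using that psums_bounds[OF pos(3)] by force
      ultimately show ?thesis
        using that snoc.prems(1) \<beta>(1) by (force simp: psums_snoc psums_append)
    qed
    then have "refined_by \<alpha> \<gamma>"
      using snoc.prems \<beta> pos by (intro snoc.IH[of \<gamma> "sum_list \<alpha>"]) (auto simp: compositions_def)
    then obtain \<gamma>s where "list_all2 (\<lambda>\<gamma> k. \<gamma> \<in> compositions k) \<gamma>s \<alpha>" "\<gamma> = concat \<gamma>s"
      by (auto simp: refined_by_def)
    moreover have "\<delta> \<in> compositions k"
      using snoc.prems \<beta> by (auto simp: compositions_def)
    ultimately show ?case
      unfolding refined_by_def using \<beta>(1)
      by (intro exI[of _ "\<gamma>s @ [\<delta>]"]) (auto intro: list_all2_appendI)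
  qed
qed

section \<open>Compositions built from sets, and products over gaps\<close>

text \<open>Pairing \<open>l\<close> with \<open>0 # l\<close>, truncated to the length of
  \<open>l\<close>, gives consecutive differences, whose partial sums telescope to the entries of
  \<open>l\<close>.\<close>

lemma map2_diff_composition:
  fixes l :: "nat list"
  assumes "sorted_wrt (<) l" "0 \<notin> set l"
  shows "(\<forall>k\<in>set (map2 (\<lambda>t u. t - u) l (0 # l)). 0 < k) \<and>
    sum_list (map2 (\<lambda>t u. t - u) l (0 # l)) = last (0 # l) \<and>
    psums (map2 (\<lambda>t u. t - u) l (0 # l)) = set l"
  using assms
proof (induction l rule: rev_induct)
  case (snoc m l)
  have *: "map2 (\<lambda>t u. t - u) (l @ [m]) (0 # l @ [m]) =
      map2 (\<lambda>t u. t - u) l (0 # l) @ [m - last (0 # l)]"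
    by (rule nth_equalityI) (auto simp: nth_append nth_Cons' last_conv_nth less_Suc_eq)
  have "last (0 # l) < m"
    using snoc.prems by (cases "l = []") (auto simp: sorted_wrt_append)
  with snoc show ?case
    unfolding * by (auto simp: psums_snoc sorted_wrt_append)
qed auto

lemma comp_of_set_psums:
  assumes "1 \<le> n" "S \<subseteq> {1..<n}"
  shows "comp_of_set n S \<in> compositions n" "psums (comp_of_set n S) = insert n S"
proof -
  define l where "l = sorted_list_of_set S @ [n]"
  have fin: "finite S" using assms(2) finite_subset by blast
  \<comment> \<open>Only the first \<open>length l\<close> entries of the second list count, so it
    may be extended to \<open>0 # l\<close>.\<close>
  have "zip l (0 # sorted_list_of_set S) = zip l ((0 # sorted_list_of_set S) @ [n])"
    by (rule zip_append2[THEN trans, symmetric]) (auto simp: l_def)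
  then have *: "comp_of_set n S = map2 (\<lambda>t u. t - u) l (0 # l)"
    by (simp add: comp_of_set_def l_def Let_def)
  have "sorted_wrt (<) l" "0 \<notin> set l"
    using assms fin by (auto simp: l_def sorted_wrt_append)
  from map2_diff_composition[OF this] show
    "comp_of_set n S \<in> compositions n" "psums (comp_of_set n S) = insert n S"
    unfolding * using fin by (auto simp: compositions_def l_def)
qed

text \<open>The part \<open>\<beta> ! (i - 1)\<close> jumps over
  \<open>\<beta> ! (i - 1) - 1\<close> numbers that are not partial sums, and exactly
  \<open>i - 1\<close> partial sums lie below each of them.\<close>

lemma prod_gaps_psums:
  fixes X :: "nat \<Rightarrow> 'a::comm_monoid_mult"
  assumes "\<forall>k\<in>set \<beta>. 0 < k"
  shows "(\<Prod>i=1..length \<beta>. X i ^ (\<beta> ! (i - 1) - 1)) =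
    (\<Prod>s\<in>{1..sum_list \<beta>} - psums \<beta>. X (card {u\<in>psums \<beta>. u < s} + 1))"
  using assms
proof (induction \<beta> rule: rev_induct)
  case (snoc b \<beta>)
  let ?m = "sum_list \<beta>"
  have bnd: "psums \<beta> \<subseteq> {1..?m}" using psums_bounds[of \<beta>] snoc.prems by auto
  have b: "0 < b" using snoc.prems by simp
  have set: "{1..sum_list (\<beta> @ [b])} - psums (\<beta> @ [b]) = ({1..?m} - psums \<beta>) \<union> {?m<..<?m + b}"
    using bnd b by (auto simp: psums_snoc)
  have old: "{u\<in>psums (\<beta> @ [b]). u < s} = {u\<in>psums \<beta>. u < s}" if "s < ?m + b" for s
    using that by (auto simp: psums_snoc)
  have new: "{u\<in>psums (\<beta> @ [b]). u < s} = psums \<beta>" if "?m < s" "s < ?m + b" for s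
    using that bnd by (auto simp: psums_snoc)
  have "(\<Prod>s\<in>{1..sum_list (\<beta> @ [b])} - psums (\<beta> @ [b]). X (card {u\<in>psums (\<beta> @ [b]). u < s} + 1)) =
      (\<Prod>s\<in>{1..?m} - psums \<beta>. X (card {u\<in>psums (\<beta> @ [b]). u < s} + 1)) *
      (\<Prod>s\<in>{?m<..<?m + b}. X (card {u\<in>psums (\<beta> @ [b]). u < s} + 1))"
    unfolding set by (rule prod.union_disjoint) auto
  also have "(\<Prod>s\<in>{1..?m} - psums \<beta>. X (card {u\<in>psums (\<beta> @ [b]). u < s} + 1)) =
      (\<Prod>s\<in>{1..?m} - psums \<beta>. X (card {u\<in>psums \<beta>. u < s} + 1))"
    using b by (intro prod.cong refl) (simp add: old)
  also have "(\<Prod>s\<in>{?m<..<?m + b}. X (card {u\<in>psums (\<beta> @ [b]). u < s} + 1)) =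
      (\<Prod>s\<in>{?m<..<?m + b}. X (length \<beta> + 1))"
    using snoc.prems by (intro prod.cong refl) (simp add: new card_psums)
  also have "\<dots> = X (length \<beta> + 1) ^ (b - 1)"
    by simp
  also have "(\<Prod>s\<in>{1..?m} - psums \<beta>. X (card {u\<in>psums \<beta>. u < s} + 1)) =
      (\<Prod>i=1..length \<beta>. X i ^ (\<beta> ! (i - 1) - 1))"
    using snoc by simp
  also have "\<dots> = (\<Prod>i=1..length \<beta>. X i ^ ((\<beta> @ [b]) ! (i - 1) - 1))"
    by (intro prod.cong refl) (auto simp: nth_append)
  finally show ?case by simp
qed auto

section \<open>The generating function of supports\<close>

lemma sum_Pow_power_card:
  fixes x :: "'a::comm_semiring_1"
  assumes "finite A"
  shows "(\<Sum>S\<in>Pow A. x ^ card S) = (x + 1) ^ card A"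
  using prod_add[OF assms, of "\<lambda>_. x" "\<lambda>_. 1"] by simp

lemma sum_Pow_minus_one_power_card:
  assumes "finite A"
  shows "(\<Sum>B\<in>Pow A. (-1) ^ card B :: 'a::comm_ring_1) = (if A = {} then 1 else 0)"
  using sum_Pow_power_card[OF assms, of "-1 :: 'a"] assms by (simp add: power_0_left)

lemma power_card_Sigma:
  assumes "finite V" "\<And>v. v \<in> V \<Longrightarrow> finite (g v)"
  shows "(x :: 'a::comm_monoid_mult) ^ card (Sigma V g) = (\<Prod>v\<in>V. x ^ card (g v))"
  using assms by (simp add: power_sum)

text \<open>A relation with domain exactly \<open>V\<close> is an independent choice of a nonempty
  successor set in \<open>T v\<close> for each \<open>v\<close>; the \<open>- 1\<close> removes the
  empty choice.\<close>

lemma sum_relations_power_card: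
  fixes x :: "'a::comm_ring_1"
  assumes "finite V" "\<And>v. v \<in> V \<Longrightarrow> finite (T v)"
  shows "(\<Sum>H | H \<subseteq> Sigma V T \<and> fst ` H = V. x ^ card H) = (\<Prod>v\<in>V. (x + 1) ^ card (T v) - 1)"
proof -
  have "(\<Prod>v\<in>V. (x + 1) ^ card (T v) - 1) = (\<Prod>v\<in>V. \<Sum>S\<in>Pow (T v) - {{}}. x ^ card S)"
    using assms by (intro prod.cong refl) (simp add: sum_diff1 sum_Pow_power_card)
  also have "\<dots> = (\<Sum>g\<in>PiE V (\<lambda>v. Pow (T v) - {{}}). \<Prod>v\<in>V. x ^ card (g v))"
    using assms by (intro prod_sum_PiE) auto
  also have "\<dots> = (\<Sum>H | H \<subseteq> Sigma V T \<and> fst ` H = V. x ^ card H)"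
  proof (rule sum.reindex_bij_witness[where j = "\<lambda>g. Sigma V g" and i = "\<lambda>H. \<lambda>v\<in>V. H `` {v}"])
    fix g assume g: "g \<in> PiE V (\<lambda>v. Pow (T v) - {{}})"
    then have sub: "\<And>v. v \<in> V \<Longrightarrow> g v \<subseteq> T v" "\<And>v. v \<in> V \<Longrightarrow> g v \<noteq> {}"
      by (auto dest!: PiE_mem)
    show "(\<lambda>v\<in>V. Sigma V g `` {v}) = g"
      using g by (intro ext) (auto simp: restrict_def PiE_def extensional_def)
    show "Sigma V g \<in> {H. H \<subseteq> Sigma V T \<and> fst ` H = V}"
      using sub by force
    show "x ^ card (Sigma V g) = (\<Prod>v\<in>V. x ^ card (g v))"
      using assms sub finite_subset by (intro power_card_Sigma) blast+
  next
    fix H assume H: "H \<in> {H. H \<subseteq> Sigma V T \<and> fst ` H = V}"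
    have "Sigma V (\<lambda>v\<in>V. H `` {v}) = Sigma V (\<lambda>v. H `` {v})"
      by (rule Sigma_cong) auto
    also have "\<dots> = H"
      using H by (auto intro: rev_image_eqI)
    finally show "Sigma V (\<lambda>v\<in>V. H `` {v}) = H" .
    have "H `` {v} \<noteq> {}" if "v \<in> V" for v
      using H that by fastforce
    then show "(\<lambda>v\<in>V. H `` {v}) \<in> PiE V (\<lambda>v. Pow (T v) - {{}})"
      using H by (intro restrict_PiE_iff[THEN iffD2] ballI) blast
  qed
  finally show ?thesis ..
qed

section \<open>Enumeration of the possible supports\<close>

definition flow_support :: "nat \<Rightarrow> (nat \<Rightarrow> nat) \<Rightarrow> (nat \<times> nat) set \<Rightarrow> bool" where
  "flow_support n a H \<longleftrightarrow> H \<subseteq> K_edges n \<and> (\<forall>i\<in>{1..n}. i \<in> fst ` H \<longleftrightarrow> a i \<noteq> 0 \<or> i \<in> snd ` H)"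

lemma finite_K_edges [simp]: "finite (K_edges n)"
  by (rule finite_subset[of _ "{..n + 1} \<times> {..n + 1}"]) (auto simp: K_edges_def)

text \<open>Splits the local condition into inclusions, so that the last one, which asks for
  incoming edges at active vertices outside the support of \<open>a\<close>, can be removed by
  inclusion-exclusion.\<close>

lemma flow_support_iff:
  "flow_support n a H \<longleftrightarrow> H \<subseteq> K_edges n \<and> {i\<in>{1..n}. a i \<noteq> 0} \<subseteq> fst ` H \<and>
    snd ` H \<subseteq> insert (n + 1) (fst ` H) \<and> fst ` H - {i\<in>{1..n}. a i \<noteq> 0} \<subseteq> snd ` H"
proof -
  have *: "(\<forall>i\<in>{1..n}. i \<in> F \<longleftrightarrow> a i \<noteq> 0 \<or> i \<in> D) \<longleftrightarrow>
      {i\<in>{1..n}. a i \<noteq> 0} \<subseteq> F \<and> D \<subseteq> insert (n + 1) F \<and> F - {i\<in>{1..n}. a i \<noteq> 0} \<subseteq> D"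
    if "F \<subseteq> {1..n}" "D \<subseteq> insert (n + 1) {1..n}" for F D
  proof -
    \<comment> \<open>The sink is not subject to the condition, hence the exceptional
      \<open>n + 1\<close>.\<close>
    have "n + 1 \<notin> {1..n}" by simp
    with that show ?thesis by blast
  qed
  have "fst ` H \<subseteq> {1..n}" "snd ` H \<subseteq> insert (n + 1) {1..n}" if "H \<subseteq> K_edges n"
    using that by (auto simp: K_edges_def)
  from *[OF this] show ?thesis
    unfolding flow_support_def by blast
qed

text \<open>Counts the possible targets of \<open>v\<close> in \<open>W\<close> together with the sink \<open>n + 1\<close>.\<close>

definition slot_count :: "nat set \<Rightarrow> nat \<Rightarrow> nat" where
  "slot_count W v = card {u\<in>W. v < u} + 1"

text \<open>With the set \<open>V\<close> of tails prescribed, each \<open>v\<close> chooses its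
  heads independently among the later elements of \<open>W\<close> and the sink, so the sum factors
  over \<open>V\<close>.\<close>

lemma sum_edge_sets:
  fixes x :: "'a::field"
  assumes "x \<noteq> 0" "W \<subseteq> {1..n}" "V \<subseteq> {1..n}"
  shows "(\<Sum>H | H \<subseteq> K_edges n \<and> fst ` H = V \<and> snd ` H \<subseteq> insert (n + 1) W. x ^ card H / x ^ card (fst ` H)) =
    (\<Prod>v\<in>V. ((x + 1) ^ slot_count W v - 1) / x)"
proof -
  define T where "T v = {u\<in>insert (n + 1) W. v < u}" for v
  have fin: "finite V" "finite W" using assms(2,3) finite_subset by blast+
  have "card (T v) = slot_count W v" if "v \<in> V" for v
  proof -
    have "T v = insert (n + 1) {u\<in>W. v < u}"
      using assms(3) that by (auto simp: T_def)
    moreover have "n + 1 \<notin> {u\<in>W. v < u}" using assms(2) by auto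
    ultimately show ?thesis using fin by (simp add: slot_count_def)
  qed
  moreover have "H \<subseteq> K_edges n \<and> fst ` H = V \<and> snd ` H \<subseteq> insert (n + 1) W \<longleftrightarrow>
      H \<subseteq> Sigma V T \<and> fst ` H = V" for H
  proof -
    have "H \<subseteq> Sigma V T" if "H \<subseteq> K_edges n" "fst ` H = V" "snd ` H \<subseteq> insert (n + 1) W"
    proof (rule subrelI)
      fix v u assume "(v, u) \<in> H"
      then have "(v, u) \<in> K_edges n" "v \<in> V" "u \<in> insert (n + 1) W"
        using that by (auto intro: rev_image_eqI)
      then show "(v, u) \<in> Sigma V T" by (simp add: K_edges_def T_def)
    qed
    moreover have "Sigma V T \<subseteq> K_edges n" "snd ` Sigma V T \<subseteq> insert (n + 1) W"
      using assms(2,3) by (force simp: K_edges_def T_def)+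
    ultimately show ?thesis by blast
  qed
  moreover have "(\<Sum>H | H \<subseteq> Sigma V T \<and> fst ` H = V. x ^ card H / x ^ card (fst ` H)) =
      (\<Sum>H | H \<subseteq> Sigma V T \<and> fst ` H = V. x ^ card H) / x ^ card V"
    by (simp add: sum_divide_distrib)
  moreover have "(\<Sum>H | H \<subseteq> Sigma V T \<and> fst ` H = V. x ^ card H) = (\<Prod>v\<in>V. (x + 1) ^ card (T v) - 1)"
    using fin by (intro sum_relations_power_card) (auto simp: T_def)
  ultimately show ?thesis by (simp add: prod_dividef)
qed

lemma sum_flow_supports:
  fixes x :: "'a::field" and n :: nat and a :: "nat \<Rightarrow> nat"
  assumes "x \<noteq> 0"
  defines "N \<equiv> {1..n}" and "A \<equiv> {i\<in>{1..n}. a i \<noteq> 0}"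
  shows "(\<Sum>H | flow_support n a H. x ^ card H / x ^ card (fst ` H)) =
    (\<Sum>W | A \<subseteq> W \<and> W \<subseteq> N. (\<Prod>v\<in>W. ((x + 1) ^ slot_count W v - 1) / x) *
      (\<Prod>v\<in>N - W. 1 - ((x + 1) ^ slot_count W v - 1) / x))"
proof -
  let ?w = "\<lambda>H :: (nat \<times> nat) set. x ^ card H / x ^ card (fst ` H)"
  let ?phi = "\<lambda>W v. ((x + 1) ^ slot_count W v - 1) / x"
  \<comment> \<open>\<open>\<H>\<close> omits the condition removed by inclusion-exclusion;
    \<open>\<B> H\<close> consists of the sets of vertices violating it.\<close>
  define \<H> where "\<H> = {H. H \<subseteq> K_edges n \<and> A \<subseteq> fst ` H \<and> snd ` H \<subseteq> insert (n + 1) (fst ` H)}"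
  define \<B> where "\<B> H = {B. B \<subseteq> fst ` H - A \<and> B \<inter> snd ` H = {}}" for H :: "(nat \<times> nat) set"
  define \<W> where "\<W> = {W. A \<subseteq> W \<and> W \<subseteq> N}"
  define \<E> where "\<E> WB = {H. H \<subseteq> K_edges n \<and> fst ` H = fst WB \<union> snd WB \<and> snd ` H \<subseteq> insert (n + 1) (fst WB)}"
    for WB :: "nat set \<times> nat set"
  have fin\<H>: "finite \<H>"
    by (rule finite_subset[of _ "Pow (K_edges n)"]) (auto simp: \<H>_def)
  have finH: "finite H" if "H \<subseteq> K_edges n" for H
    using that by (rule finite_subset) simp
  have fstN: "fst ` H \<subseteq> N" if "H \<subseteq> K_edges n" for H
    using that by (auto simp: K_edges_def N_def)
  have fin\<B>: "finite (\<B> H)" if "H \<in> \<H>" for H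
  proof (rule finite_subset)
    show "\<B> H \<subseteq> Pow (fst ` H)" by (auto simp: \<B>_def)
    show "finite (Pow (fst ` H))" using that finH by (simp add: \<H>_def)
  qed
  have fin\<W>: "finite \<W>"
    by (rule finite_subset[of _ "Pow N"]) (auto simp: \<W>_def N_def)
  have fin\<E>: "finite (\<E> p)" for p
    by (rule finite_subset[of _ "Pow (K_edges n)"]) (auto simp: \<E>_def)
  \<comment> \<open>The alternating sum over all subsets of the violating vertices is
    \<open>1\<close> if there are none and \<open>0\<close> otherwise.\<close>
  have ie: "(\<Sum>B\<in>\<B> H. (-1) ^ card B * ?w H) = (if fst ` H - A \<subseteq> snd ` H then ?w H else 0)"
    if "H \<in> \<H>" for H
  proof -
    have "\<B> H = Pow (fst ` H - A - snd ` H)" by (auto simp: \<B>_def)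
    then have "(\<Sum>B\<in>\<B> H. (-1) ^ card B :: 'a) = (if fst ` H - A \<subseteq> snd ` H then 1 else 0)"
      using sum_Pow_minus_one_power_card[of "fst ` H - A - snd ` H"] that finH
      by (auto simp: \<H>_def)
    then show ?thesis by (simp add: sum_distrib_right[symmetric] del: times_divide_eq_right)
  qed
  have "(\<Sum>H | flow_support n a H. ?w H) = (\<Sum>H\<in>{H\<in>\<H>. fst ` H - A \<subseteq> snd ` H}. ?w H)"
    by (rule sum.cong) (auto simp: flow_support_iff \<H>_def A_def)
  also have "\<dots> = (\<Sum>H\<in>\<H>. if fst ` H - A \<subseteq> snd ` H then ?w H else 0)"
    using fin\<H> by (rule sum.inter_filter)
  also have "\<dots> = (\<Sum>H\<in>\<H>. \<Sum>B\<in>\<B> H. (-1) ^ card B * ?w H)"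
    by (intro sum.cong refl ie[symmetric])
  also have "\<dots> = (\<Sum>(H, B)\<in>Sigma \<H> \<B>. (-1) ^ card B * ?w H)"
    using fin\<H> fin\<B> by (intro sum.Sigma) auto
  \<comment> \<open>The tails split into \<open>B\<close> and the rest \<open>W\<close>. As no head
    lies in \<open>B\<close>, every head lies in \<open>W\<close> or is the sink, so
    \<open>H\<close> can be summed last with \<open>(W, B)\<close> fixed.\<close>
  also have "\<dots> = (\<Sum>(p, H)\<in>Sigma (Sigma \<W> (\<lambda>W. Pow (N - W))) \<E>. (-1) ^ card (snd p) * ?w H)"
  proof (rule sum.reindex_bij_witness[where i = "\<lambda>(p, H). (H, snd p)"
        and j = "\<lambda>(H, B). ((fst ` H - B, B), H)"])
    fix q assume "q \<in> Sigma \<H> \<B>"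
    then obtain H B where q: "q = (H, B)" and H: "H \<in> \<H>" "B \<in> \<B> H" by auto
    then have "fst ` H \<subseteq> N" using fstN by (auto simp: \<H>_def)
    with H have "fst ` H - B \<in> \<W>" "B \<subseteq> N - (fst ` H - B)" "H \<in> \<E> (fst ` H - B, B)"
      unfolding \<H>_def \<B>_def \<W>_def \<E>_def by (simp; blast)+
    then show "(case q of (H, B) \<Rightarrow> ((fst ` H - B, B), H)) \<in> Sigma (Sigma \<W> (\<lambda>W. Pow (N - W))) \<E>"
      by (simp add: q)
  next
    fix q assume "q \<in> Sigma (Sigma \<W> (\<lambda>W. Pow (N - W))) \<E>"
    then obtain W B H where q: "q = ((W, B), H)" and W: "W \<in> \<W>" "B \<subseteq> N - W" "H \<in> \<E> (W, B)"
      by auto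
    have F: "fst ` H = W \<union> B" "snd ` H \<subseteq> insert (n + 1) W" "H \<subseteq> K_edges n"
      using W(3) by (auto simp: \<E>_def)
    have A: "A \<subseteq> W" using W(1) by (simp add: \<W>_def)
    have "n + 1 \<notin> N" by (simp add: N_def)
    with A W(2) have "A \<subseteq> W \<union> B" "B \<subseteq> W \<union> B - A" "\<And>D. D \<subseteq> insert (n + 1) W \<Longrightarrow> B \<inter> D = {}"
      "insert (n + 1) W \<subseteq> insert (n + 1) (W \<union> B)"
      by blast+
    with F have "H \<in> \<H>" "B \<in> \<B> H"
      unfolding \<H>_def \<B>_def by auto
    moreover have "fst ` H - B = W" using F(1) W(2) by blast
    ultimately show "(case q of (p, H) \<Rightarrow> (H, snd p)) \<in> Sigma \<H> \<B>"
      and "(case (case q of (p, H) \<Rightarrow> (H, snd p)) of (H, B) \<Rightarrow> ((fst ` H - B, B), H)) = q"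
      by (simp_all add: q)
  qed auto
  also have "\<dots> = (\<Sum>p\<in>Sigma \<W> (\<lambda>W. Pow (N - W)). (-1) ^ card (snd p) * (\<Sum>H\<in>\<E> p. ?w H))"
    using fin\<W> fin\<E> by (subst sum.Sigma[symmetric]) (auto simp: N_def sum_distrib_left)
  also have "\<dots> = (\<Sum>p\<in>Sigma \<W> (\<lambda>W. Pow (N - W)). (-1) ^ card (snd p) * (\<Prod>v\<in>fst p \<union> snd p. ?phi (fst p) v))"
    using assms(1) unfolding \<E>_def
    by (intro sum.cong refl, subst sum_edge_sets) (auto simp: \<W>_def N_def)
  also have "\<dots> = (\<Sum>W\<in>\<W>. \<Sum>B\<in>Pow (N - W). (-1) ^ card B * (\<Prod>v\<in>W \<union> B. ?phi W v))"
    using fin\<W> by (subst sum.Sigma) (auto simp: N_def case_prod_unfold)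
  also have "\<dots> = (\<Sum>W\<in>\<W>. (\<Prod>v\<in>W. ?phi W v) * (\<Prod>v\<in>N - W. 1 - ?phi W v))"
  proof (intro sum.cong refl)
    fix W assume "W \<in> \<W>"
    then have fin: "finite W" "finite (N - W)"
      using finite_subset by (auto simp: \<W>_def N_def)
    \<comment> \<open>The sign is distributed over the elements of \<open>B\<close>; the sum over
      subsets is then the expansion of a product of factors \<open>1 - ?phi W v\<close>.\<close>
    have "(\<Sum>B\<in>Pow (N - W). (-1) ^ card B * (\<Prod>v\<in>W \<union> B. ?phi W v)) =
        (\<Prod>v\<in>W. ?phi W v) * (\<Sum>B\<in>Pow (N - W). \<Prod>v\<in>B. - ?phi W v)"
      unfolding sum_distrib_left
    proof (intro sum.cong refl)
      fix B assume "B \<in> Pow (N - W)"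
      then have "(\<Prod>v\<in>W \<union> B. ?phi W v) = (\<Prod>v\<in>W. ?phi W v) * (\<Prod>v\<in>B. ?phi W v)"
        using fin finite_subset by (intro prod.union_disjoint) auto
      then show "(-1) ^ card B * (\<Prod>v\<in>W \<union> B. ?phi W v) = (\<Prod>v\<in>W. ?phi W v) * (\<Prod>v\<in>B. - ?phi W v)"
        by (simp add: prod_uminus)
    qed
    also have "(\<Sum>B\<in>Pow (N - W). \<Prod>v\<in>B. - ?phi W v) = (\<Prod>v\<in>N - W. 1 - ?phi W v)"
      using prod_add[OF fin(2), of "\<lambda>v. - ?phi W v" "\<lambda>_. 1"] by simp
    finally show "(\<Sum>B\<in>Pow (N - W). (-1) ^ card B * (\<Prod>v\<in>W \<union> B. ?phi W v)) =
        (\<Prod>v\<in>W. ?phi W v) * (\<Prod>v\<in>N - W. 1 - ?phi W v)" .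
  qed
  finally show ?thesis by (simp add: \<W>_def)
qed

text \<open>Taken from right to left, the elements of \<open>W\<close> have the slot counts
  \<open>1, 2, ..., card W\<close>.\<close>

lemma prod_slot_count:
  fixes X :: "nat \<Rightarrow> 'a::comm_monoid_mult"
  assumes "finite W"
  shows "(\<Prod>v\<in>W. X (slot_count W v)) = (\<Prod>i=1..card W. X i)"
  using assms
proof (induction W rule: finite_linorder_min_induct)
  case (insert b W)
  have "b \<notin> W" using insert by blast
  have "{u\<in>insert b W. b < u} = W" using insert by auto
  then have "slot_count (insert b W) b = card W + 1" by (simp add: slot_count_def)
  moreover have "slot_count (insert b W) v = slot_count W v" if "v \<in> W" for v
  proof -
    have "{u\<in>insert b W. v < u} = {u\<in>W. v < u}" using that insert by auto
    then show ?thesis by (simp add: slot_count_def)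
  qed
  ultimately show ?case
    using insert \<open>b \<notin> W\<close> by (simp add: mult.commute)
qed auto

text \<open>Each of the \<open>n\<close> vertices contributes one factor \<open>1 / x\<close>. The
  numerators over \<open>W\<close> multiply to \<open>pi_poly\<close>, and each vertex outside
  \<open>W\<close> gives a sign, since \<open>1 - (y - 1) / x = - (y - (x + 1)) / x\<close>.\<close>

lemma prod_slot_weights:
  fixes x :: "'a::field"
  assumes "x \<noteq> 0" "W \<subseteq> {1..n}"
  shows "(\<Prod>v\<in>W. ((x + 1) ^ slot_count W v - 1) / x) *
      (\<Prod>v\<in>{1..n} - W. 1 - ((x + 1) ^ slot_count W v - 1) / x) =
    1 / x ^ n * ((-1) ^ (n - card W) * pi_poly (card W) x *
      (\<Prod>v\<in>{1..n} - W. (x + 1) ^ slot_count W v - (x + 1)))"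
proof -
  have fin: "finite W" using assms(2) finite_subset by blast
  have card: "card ({1..n} - W) = n - card W" "card W \<le> n"
    using assms(2) fin card_mono[OF _ assms(2)] by (auto simp: card_Diff_subset)
  have "(\<Prod>v\<in>W. ((x + 1) ^ slot_count W v - 1) / x) = pi_poly (card W) x / x ^ card W"
    using prod_slot_count[OF fin, of "\<lambda>i. (x + 1) ^ i - 1"] by (simp add: prod_dividef pi_poly_def)
  moreover have "(\<Prod>v\<in>{1..n} - W. 1 - ((x + 1) ^ slot_count W v - 1) / x) =
      (\<Prod>v\<in>{1..n} - W. - ((x + 1) ^ slot_count W v - (x + 1)) / x)"
    using assms(1) by (intro prod.cong refl) (simp add: field_simps)
  moreover have "\<dots> = (-1) ^ (n - card W) *
      (\<Prod>v\<in>{1..n} - W. (x + 1) ^ slot_count W v - (x + 1)) / x ^ (n - card W)"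
    unfolding prod_dividef prod_uminus prod_constant card(1) ..
  moreover have "x ^ n = x ^ card W * x ^ (n - card W)"
    using card by (simp add: power_add[symmetric])
  ultimately show ?thesis by simp
qed

section \<open>Reading vertex sets from right to left\<close>

text \<open>A nonzero entry \<open>a (j + 1)\<close> is recorded as
  \<open>n - j = n + 1 - (j + 1)\<close>. The entry \<open>a 1\<close> accounts for the total
  \<open>n\<close>, which is always a partial sum.\<close>

lemma psums_revcomp:
  assumes "1 \<le> n" "a 1 \<noteq> 0"
  shows "revcomp n a \<in> compositions n"
    "psums (revcomp n a) = (\<lambda>i. n + 1 - i) ` {i\<in>{1..n}. a i \<noteq> 0}"
proof -
  let ?S = "{n - j | j. j \<in> {1..n-1} \<and> a (j + 1) \<noteq> 0}"
  have S: "?S \<subseteq> {1..<n}" by auto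
  show "revcomp n a \<in> compositions n"
    using comp_of_set_psums(1)[OF assms(1) S] by (simp add: revcomp_def)
  have "(\<lambda>i. n + 1 - i) ` {i\<in>{1..n}. a i \<noteq> 0} = insert n ?S"
  proof (intro equalityI subsetI)
    fix s assume "s \<in> (\<lambda>i. n + 1 - i) ` {i\<in>{1..n}. a i \<noteq> 0}"
    then obtain i where i: "i \<in> {1..n}" "a i \<noteq> 0" "s = n + 1 - i" by auto
    show "s \<in> insert n ?S"
    proof (cases "i = 1")
      case False
      then have "s = n - (i - 1) \<and> i - 1 \<in> {1..n-1} \<and> a (i - 1 + 1) \<noteq> 0" using i by auto
      then show ?thesis by blast
    qed (use i in auto)
  next
    fix s assume "s \<in> insert n ?S"
    then consider "s = n" | j where "s = n - j" "j \<in> {1..n-1}" "a (j + 1) \<noteq> 0" by auto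
    then show "s \<in> (\<lambda>i. n + 1 - i) ` {i\<in>{1..n}. a i \<noteq> 0}"
    proof cases
      case 1
      then show ?thesis using assms by (intro image_eqI[of _ _ 1]) auto
    next
      case (2 j)
      then show ?thesis by (intro image_eqI[of _ _ "j + 1"]) auto
    qed
  qed
  then show "psums (revcomp n a) = (\<lambda>i. n + 1 - i) ` {i\<in>{1..n}. a i \<noteq> 0}"
    using comp_of_set_psums(2)[OF assms(1) S] by (simp add: revcomp_def)
qed

lemma bij_betw_reflect: "bij_betw (\<lambda>i. n + 1 - i) {1..n} {1..n::nat}"
  by (rule bij_betwI[where g = "\<lambda>i. n + 1 - i"]) auto

lemma reflect_image_subset: "S \<subseteq> {1..n} \<Longrightarrow> (\<lambda>i. n + 1 - i) ` S \<subseteq> {1..n::nat}"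
  using bij_betw_imp_surj_on[OF bij_betw_reflect[of n]] by blast

lemma reflect_image_image:
  assumes "S \<subseteq> {1..n::nat}"
  shows "(\<lambda>i. n + 1 - i) ` (\<lambda>i. n + 1 - i) ` S = S"
proof -
  have "(\<lambda>i. n + 1 - (n + 1 - i)) ` S = (\<lambda>i. i) ` S"
    using assms by (intro image_cong refl) (auto simp: subset_iff)
  then show ?thesis by (simp add: image_image)
qed

text \<open>Refinements of \<open>revcomp n a\<close> are the compositions whose partial sums
  contain the reflected support of \<open>a\<close>; reflecting back gives the sets \<open>W\<close>
  of the generating function.\<close>

lemma bij_betw_refinements:
  assumes "1 \<le> n" "a 1 \<noteq> 0"
  shows "bij_betw (\<lambda>\<beta>. (\<lambda>s. n + 1 - s) ` psums \<beta>)
    {\<beta>. \<beta> \<in> compositions n \<and> refined_by (revcomp n a) \<beta>}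
    {W. {i\<in>{1..n}. a i \<noteq> 0} \<subseteq> W \<and> W \<subseteq> {1..n}}"
proof -
  let ?r = "\<lambda>s. n + 1 - s" and ?A = "{i\<in>{1..n}. a i \<noteq> 0}"
  note inv = reflect_image_image
  \<comment> \<open>Since \<open>a 1\<close> is nonzero, every superset of the reflected support
    within \<open>{1..n}\<close> contains \<open>n\<close>, and so is the set of partial sums of a
    composition.\<close>
  have n: "n \<in> ?r ` ?A" using assms by (intro image_eqI[of _ _ 1]) auto
  have "bij_betw psums {\<beta>. \<beta> \<in> compositions n \<and> refined_by (revcomp n a) \<beta>}
      {S. ?r ` ?A \<subseteq> S \<and> S \<subseteq> {1..n}}"
  proof (rule bij_betw_subset[OF bij_betw_psums[OF assms(1)]])
    have "{\<beta>. \<beta> \<in> compositions n \<and> refined_by (revcomp n a) \<beta>} =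
        {\<beta>\<in>compositions n. ?r ` ?A \<subseteq> psums \<beta>}"
      using refined_by_iff_psums psums_revcomp[where a = a, OF assms] by metis
    then have "psums ` {\<beta>. \<beta> \<in> compositions n \<and> refined_by (revcomp n a) \<beta>} =
        {S\<in>psums ` compositions n. ?r ` ?A \<subseteq> S}"
      by auto
    also have "\<dots> = {S. ?r ` ?A \<subseteq> S \<and> S \<subseteq> {1..n}}"
      unfolding bij_betw_imp_surj_on[OF bij_betw_psums[OF assms(1)]] using subsetD[OF _ n] by auto
    finally show "psums ` {\<beta>. \<beta> \<in> compositions n \<and> refined_by (revcomp n a) \<beta>} =
        {S. ?r ` ?A \<subseteq> S \<and> S \<subseteq> {1..n}}" .
  qed auto
  moreover have "bij_betw (image ?r) {S. ?r ` ?A \<subseteq> S \<and> S \<subseteq> {1..n}} {W. ?A \<subseteq> W \<and> W \<subseteq> {1..n}}"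
  proof (rule bij_betwI[where g = "image ?r"])
    show "image ?r \<in> {S. ?r ` ?A \<subseteq> S \<and> S \<subseteq> {1..n}} \<rightarrow> {W. ?A \<subseteq> W \<and> W \<subseteq> {1..n}}"
    proof
      fix S assume S: "S \<in> {S. ?r ` ?A \<subseteq> S \<and> S \<subseteq> {1..n}}"
      then have "?r ` ?r ` ?A \<subseteq> ?r ` S" by blast
      moreover have "?r ` ?r ` ?A = ?A" by (rule inv) auto
      moreover have "?r ` S \<subseteq> {1..n}" using S by (intro reflect_image_subset) simp
      ultimately show "?r ` S \<in> {W. ?A \<subseteq> W \<and> W \<subseteq> {1..n}}" by simp
    qed
    show "image ?r \<in> {W. ?A \<subseteq> W \<and> W \<subseteq> {1..n}} \<rightarrow> {S. ?r ` ?A \<subseteq> S \<and> S \<subseteq> {1..n}}"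
    proof
      fix W assume "W \<in> {W. ?A \<subseteq> W \<and> W \<subseteq> {1..n}}"
      then show "?r ` W \<in> {S. ?r ` ?A \<subseteq> S \<and> S \<subseteq> {1..n}}"
        using reflect_image_subset[of W n] by (simp add: image_mono)
    qed
  qed (rule inv, simp)+
  ultimately have "bij_betw (image ?r \<circ> psums) {\<beta>. \<beta> \<in> compositions n \<and> refined_by (revcomp n a) \<beta>}
      {W. ?A \<subseteq> W \<and> W \<subseteq> {1..n}}" by (rule bij_betw_trans)
  then show ?thesis by (simp add: o_def)
qed

text \<open>Reflection turns the elements after \<open>v\<close> into the partial sums before its
  mirror image, so the slot counts become the indices in \<open>prod_gaps_psums\<close>.\<close>

lemma prod_gaps_reflect:
  fixes X :: "nat \<Rightarrow> 'a::comm_monoid_mult"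
  assumes "\<beta> \<in> compositions n"
  shows "(\<Prod>v\<in>{1..n} - (\<lambda>s. n + 1 - s) ` psums \<beta>. X (slot_count ((\<lambda>s. n + 1 - s) ` psums \<beta>) v)) =
    (\<Prod>i=1..length \<beta>. X i ^ (\<beta> ! (i - 1) - 1))"
proof -
  let ?r = "\<lambda>s. n + 1 - s"
  have \<beta>: "\<forall>k\<in>set \<beta>. 0 < k" "sum_list \<beta> = n" using assms by (auto simp: compositions_def)
  have sub: "psums \<beta> \<subseteq> {1..n}" using psums_bounds[OF \<beta>(1)] \<beta>(2) by simp
  have "slot_count (?r ` psums \<beta>) v = card {u\<in>psums \<beta>. u < ?r v} + 1" if "v \<in> {1..n}" for v
  proof -
    have "{u\<in>?r ` psums \<beta>. v < u} = ?r ` {u\<in>psums \<beta>. u < ?r v}"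
    proof (intro equalityI subsetI)
      fix u assume "u \<in> {u\<in>?r ` psums \<beta>. v < u}"
      then obtain s where "s \<in> psums \<beta>" "u = ?r s" "v < ?r s" by auto
      then show "u \<in> ?r ` {u\<in>psums \<beta>. u < ?r v}" by auto
    next
      fix u assume "u \<in> ?r ` {u\<in>psums \<beta>. u < ?r v}"
      then obtain s where "s \<in> psums \<beta>" "u = ?r s" "s < ?r v" by auto
      then show "u \<in> {u\<in>?r ` psums \<beta>. v < u}" by auto
    qed
    moreover have "inj_on ?r {u\<in>psums \<beta>. u < ?r v}"
      using sub by (intro inj_on_subset[OF bij_betw_imp_inj_on[OF bij_betw_reflect[of n]]]) auto
    ultimately show ?thesis by (simp add: slot_count_def card_image)
  qed
  then have "(\<Prod>v\<in>{1..n} - ?r ` psums \<beta>. X (slot_count (?r ` psums \<beta>) v)) =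
      (\<Prod>v\<in>{1..n} - ?r ` psums \<beta>. X (card {u\<in>psums \<beta>. u < ?r v} + 1))"
    by (intro prod.cong refl) auto
  also have "\<dots> = (\<Prod>s\<in>{1..n} - psums \<beta>. X (card {u\<in>psums \<beta>. u < s} + 1))"
  proof (rule prod.reindex_bij_betw)
    have "bij_betw ?r ({1..n} - ?r ` psums \<beta>) (?r ` ({1..n} - ?r ` psums \<beta>))"
      by (rule bij_betw_subset[OF bij_betw_reflect]) auto
    moreover have "?r ` ({1..n} - ?r ` psums \<beta>) = {1..n} - psums \<beta>"
    proof -
      have "?r ` ({1..n} - ?r ` psums \<beta>) = ?r ` {1..n} - ?r ` ?r ` psums \<beta>"
        using reflect_image_subset[OF sub]
        by (intro inj_on_image_set_diff[OF bij_betw_imp_inj_on[OF bij_betw_reflect]]) auto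
      moreover have "?r ` ?r ` psums \<beta> = psums \<beta>"
        using sub by (rule reflect_image_image)
      ultimately show ?thesis
        using bij_betw_imp_surj_on[OF bij_betw_reflect[of n]] by simp
    qed
    ultimately show "bij_betw ?r ({1..n} - ?r ` psums \<beta>) ({1..n} - psums \<beta>)" by simp
  qed
  finally show ?thesis using prod_gaps_psums[OF \<beta>(1), of X] \<beta>(2) by simp
qed

text \<open>Under the bijection with refinements, the size of \<open>W\<close> becomes the number of
  parts, and the slot counts outside \<open>W\<close> give the monomial. The term
  \<open>1 / x\<close> stands for the empty face.\<close>

lemma sum_flow_supports_eq_Q_poly:
  fixes x :: "'a::field"
  assumes "x \<noteq> 0" "1 \<le> n" "a 1 \<noteq> 0"
  shows "1 / x + (\<Sum>H | flow_support n a H. x ^ card H / x ^ card (fst ` H)) =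
    Q_poly (revcomp n a) x (\<lambda>i. (x + 1) ^ i - (x + 1))"
proof -
  let ?r = "\<lambda>s. n + 1 - s"
  let ?X = "\<lambda>i. (x + 1) ^ i - (x + 1)"
  let ?h = "\<lambda>W. 1 / x ^ n * ((-1) ^ (n - card W) * pi_poly (card W) x *
      (\<Prod>v\<in>{1..n} - W. (x + 1) ^ slot_count W v - (x + 1)))"
  have n: "sum_list (revcomp n a) = n"
    using psums_revcomp(1)[where a = a, OF assms(2,3)] by (simp add: compositions_def)
  have "(\<Sum>H | flow_support n a H. x ^ card H / x ^ card (fst ` H)) =
      (\<Sum>W | {i\<in>{1..n}. a i \<noteq> 0} \<subseteq> W \<and> W \<subseteq> {1..n}. ?h W)"
    unfolding sum_flow_supports[OF assms(1)] by (intro sum.cong refl prod_slot_weights assms) simp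
  also have "\<dots> = (\<Sum>\<beta> | \<beta> \<in> compositions n \<and> refined_by (revcomp n a) \<beta>. ?h (?r ` psums \<beta>))"
    by (rule sum.reindex_bij_betw[OF bij_betw_refinements[where a = a, OF assms(2,3)], symmetric])
  also have "\<dots> = (\<Sum>\<beta> | \<beta> \<in> compositions n \<and> refined_by (revcomp n a) \<beta>.
      1 / x ^ n * ((-1) ^ (n - length \<beta>) * pi_poly (length \<beta>) x *
        (\<Prod>i=1..length \<beta>. ?X i ^ (\<beta> ! (i - 1) - 1))))"
  proof (intro sum.cong refl)
    fix \<beta> assume "\<beta> \<in> {\<beta>. \<beta> \<in> compositions n \<and> refined_by (revcomp n a) \<beta>}"
    then have \<beta>: "\<beta> \<in> compositions n" by simp
    then have pos: "\<forall>k\<in>set \<beta>. 0 < k" "sum_list \<beta> = n" by (auto simp: compositions_def)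
    have "psums \<beta> \<subseteq> {1..n}" using psums_bounds[OF pos(1)] pos(2) by simp
    then have "inj_on ?r (psums \<beta>)"
      using bij_betw_imp_inj_on[OF bij_betw_reflect] inj_on_subset by blast
    then have "card (?r ` psums \<beta>) = length \<beta>"
      using card_psums[OF pos(1)] by (simp add: card_image)
    then show "?h (?r ` psums \<beta>) = 1 / x ^ n * ((-1) ^ (n - length \<beta>) * pi_poly (length \<beta>) x *
        (\<Prod>i=1..length \<beta>. ?X i ^ (\<beta> ! (i - 1) - 1)))"
      using prod_gaps_reflect[OF \<beta>, of ?X] by simp
  qed
  also have "\<dots> = 1 / x ^ n * (\<Sum>\<beta> | \<beta> \<in> compositions n \<and> refined_by (revcomp n a) \<beta>.
      (-1) ^ (n - length \<beta>) * pi_poly (length \<beta>) x * (\<Prod>i=1..length \<beta>. ?X i ^ (\<beta> ! (i - 1) - 1)))"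
    by (rule sum_distrib_left[symmetric])
  finally show ?thesis by (simp add: Q_poly_def n)
qed

section \<open>Faces of the flow polytope\<close>

text \<open>Outflow equals \<open>a i\<close> plus inflow. As all values are nonnegative, each side
  is nonzero iff one of its summands is.\<close>

lemma is_flow_support:
  assumes "is_flow n a f"
  shows "flow_support n a {uv\<in>K_edges n. f uv \<noteq> 0}"
  unfolding flow_support_def
proof (intro conjI ballI)
  fix i assume i: "i \<in> {1..n}"
  let ?H = "{uv\<in>K_edges n. f uv \<noteq> 0}"
  have nn: "\<And>j. j \<in> {i<..n+1} \<Longrightarrow> 0 \<le> f (i, j)" "\<And>k. k \<in> {1..<i} \<Longrightarrow> 0 \<le> f (k, i)"
    using assms i by (auto simp: is_flow_def K_edges_def)
  have "i \<in> fst ` ?H \<longleftrightarrow> (\<exists>j\<in>{i<..n+1}. f (i, j) \<noteq> 0)"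
    using i by (force simp: K_edges_def)
  also have "\<dots> \<longleftrightarrow> (\<Sum>j\<in>{i<..n+1}. f (i, j)) \<noteq> 0"
    using nn by (subst sum_nonneg_eq_0_iff) auto
  also have "(\<Sum>j\<in>{i<..n+1}. f (i, j)) = real (a i) + (\<Sum>k\<in>{1..<i}. f (k, i))"
  proof -
    have "(\<Sum>j\<in>{i<..n+1}. f (i, j)) - (\<Sum>k\<in>{1..<i}. f (k, i)) = real (a i)"
      using assms i unfolding is_flow_def by blast
    then show ?thesis by simp
  qed
  also have "\<dots> \<noteq> 0 \<longleftrightarrow> a i \<noteq> 0 \<or> (\<Sum>k\<in>{1..<i}. f (k, i)) \<noteq> 0"
    using sum_nonneg[of "{1..<i}" "\<lambda>k. f (k, i)"] nn(2) by (auto simp: add_nonneg_eq_0_iff)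
  also have "(\<Sum>k\<in>{1..<i}. f (k, i)) \<noteq> 0 \<longleftrightarrow> (\<exists>k\<in>{1..<i}. f (k, i) \<noteq> 0)"
    using nn by (subst sum_nonneg_eq_0_iff) auto
  also have "\<dots> \<longleftrightarrow> i \<in> snd ` ?H"
    using i by (force simp: K_edges_def)
  finally show "i \<in> fst ` ?H \<longleftrightarrow> a i \<noteq> 0 \<or> i \<in> snd ` ?H" .
qed auto

text \<open>The amount passing through a vertex when every vertex distributes what it receives
  equally among its outgoing edges in \<open>H\<close>.\<close>

fun throughput :: "(nat \<Rightarrow> nat) \<Rightarrow> (nat \<times> nat) set \<Rightarrow> nat \<Rightarrow> real" where
  "throughput a H i = real (a i) +
     (\<Sum>k\<in>{1..<i}. if (k, i) \<in> H then throughput a H k / real (card (H `` {k})) else 0)"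

declare throughput.simps [simp del]

lemma throughput_nonneg: "0 \<le> throughput a H i"
proof (induction i rule: less_induct)
  case (less i)
  then show ?case
    by (subst throughput.simps) (auto intro!: add_nonneg_nonneg sum_nonneg divide_nonneg_nonneg)
qed

text \<open>Induction along the vertex order: an active vertex has \<open>a i\<close> positive or
  receives a positive share from an earlier active vertex.\<close>

lemma throughput_pos:
  assumes "flow_support n a H" "i \<in> fst ` H"
  shows "0 < throughput a H i"
  using assms(2)
proof (induction i rule: less_induct)
  case (less i)
  have sub: "H \<subseteq> K_edges n" using assms(1) by (simp add: flow_support_def)
  then have fin: "finite H" using finite_K_edges finite_subset by blast
  define s where "s = (\<Sum>k\<in>{1..<i}. if (k, i) \<in> H then throughput a H k / real (card (H `` {k})) else 0)"
  have eq: "throughput a H i = real (a i) + s"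
    by (subst throughput.simps) (simp add: s_def)
  have "0 \<le> s"
    unfolding s_def by (intro sum_nonneg) (auto intro!: divide_nonneg_nonneg throughput_nonneg)
  have i: "i \<in> {1..n}" using less.prems sub by (auto simp: K_edges_def)
  show ?case
  proof (cases "a i = 0")
    case True
    then have "i \<in> snd ` H" using assms(1) i less.prems by (auto simp: flow_support_def)
    then obtain k where k: "(k, i) \<in> H" by auto
    then have ki: "k \<in> {1..<i}" using sub by (auto simp: K_edges_def)
    have "k \<in> fst ` H" using k by (rule rev_image_eqI) simp
    then have "0 < throughput a H k" using less.IH ki by auto
    moreover have "0 < card (H `` {k})" using k fin by (auto simp: card_gt_0_iff)
    ultimately have "0 < throughput a H k / real (card (H `` {k}))" by simp
    then have "0 < s"
      unfolding s_def using k ki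
      by (intro sum_pos2[of _ k]) (auto intro!: divide_nonneg_nonneg throughput_nonneg)
    then show ?thesis by (simp add: eq)
  qed (use \<open>0 \<le> s\<close> eq in simp)
qed

text \<open>Equal splitting of the throughput satisfies the balance equations, and its values are
  positive exactly on \<open>H\<close>.\<close>

lemma flow_support_imp_flow:
  assumes "flow_support n a H"
  obtains f where "is_flow n a f" "{uv\<in>K_edges n. f uv \<noteq> 0} = H"
proof
  let ?t = "throughput a H"
  define f where "f uv = (if uv \<in> H then ?t (fst uv) / real (card (H `` {fst uv})) else 0)" for uv
  have sub: "H \<subseteq> K_edges n" using assms by (simp add: flow_support_def)
  then have fin: "finite H" using finite_K_edges finite_subset by blast
  show "is_flow n a f"
    unfolding is_flow_def
  proof (intro conjI ballI)
    show "0 \<le> f uv" for uv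
      by (auto simp: f_def intro!: divide_nonneg_nonneg throughput_nonneg)
  next
    fix i assume i: "i \<in> {1..n}"
    have inflow: "?t i = real (a i) + (\<Sum>k\<in>{1..<i}. f (k, i))"
      unfolding f_def fst_conv by (rule throughput.simps)
    have "(\<Sum>j\<in>{i<..n+1}. f (i, j)) = (\<Sum>j\<in>{j\<in>{i<..n+1}. (i, j) \<in> H}. ?t i / real (card (H `` {i})))"
      unfolding f_def fst_conv by (rule sum.inter_filter[symmetric]) simp
    also have "{j\<in>{i<..n+1}. (i, j) \<in> H} = H `` {i}"
      using sub by (auto simp: K_edges_def)
    also have "(\<Sum>j\<in>H `` {i}. ?t i / real (card (H `` {i}))) = ?t i"
    proof (cases "H `` {i} = {}")
      \<comment> \<open>Without outgoing edges the vertex is not fed at all, so its throughput is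
        \<open>0\<close>, as is the empty sum.\<close>
      case True
      then have "i \<notin> fst ` H" by auto
      then have "a i = 0" "i \<notin> snd ` H" using assms i by (auto simp: flow_support_def)
      moreover from this have "f (k, i) = 0" for k by (force simp: f_def)
      ultimately show ?thesis using True inflow by simp
    next
      case False
      have "finite (H `` {i})" using fin by auto
      with False show ?thesis by simp
    qed
    finally show "(\<Sum>j\<in>{i<..n+1}. f (i, j)) - (\<Sum>k\<in>{1..<i}. f (k, i)) = real (a i)"
      using inflow by simp
  qed
  show "{uv\<in>K_edges n. f uv \<noteq> 0} = H"
  proof (intro equalityI subsetI)
    fix uv assume uv: "uv \<in> H"
    then have "fst uv \<in> fst ` H" by simp
    moreover from uv have "snd uv \<in> H `` {fst uv}" by simp
    then have "0 < card (H `` {fst uv})" using fin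
      by (metis card_gt_0_iff empty_iff finite_Image)
    ultimately show "uv \<in> {uv\<in>K_edges n. f uv \<noteq> 0}"
      using uv sub throughput_pos[OF assms, of "fst uv"] by (auto simp: f_def)
  qed (auto simp: f_def split: if_splits)
qed

section \<open>The polytope in edge coordinates\<close>

text \<open>Row \<open>i\<close> of the signed incidence matrix, the normal vector of the balance
  equation at vertex \<open>i\<close>.\<close>

definition net :: "('e::finite \<Rightarrow> nat \<times> nat) \<Rightarrow> nat \<Rightarrow> real ^ 'e" where
  "net e i = (\<chi> \<epsilon>. of_bool (fst (e \<epsilon>) = i) - of_bool (snd (e \<epsilon>) = i))"

lemma net_nth [simp]: "net e i $ \<epsilon> = of_bool (fst (e \<epsilon>) = i) - of_bool (snd (e \<epsilon>) = i)"
  by (simp add: net_def)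

definition supp :: "('e::finite \<Rightarrow> nat \<times> nat) \<Rightarrow> real ^ 'e \<Rightarrow> (nat \<times> nat) set" where
  "supp e x = {e \<epsilon> | \<epsilon>. x $ \<epsilon> \<noteq> 0}"

definition flow_face :: "('e::finite \<Rightarrow> nat \<times> nat) \<Rightarrow> nat \<Rightarrow> (nat \<Rightarrow> nat) \<Rightarrow> (nat \<times> nat) set \<Rightarrow> (real ^ 'e) set" where
  "flow_face e n a H = {x\<in>Flow e n a. supp e x \<subseteq> H}"

text \<open>Take the least ratio of \<open>x\<close> to \<open>y\<close> over the coordinates where
  \<open>y\<close> is positive; there \<open>x\<close> is positive as well. This allows a move from
  \<open>x\<close> directly away from \<open>y\<close> within the nonnegative orthant.\<close>

lemma pos_multiple_le:
  fixes x y :: "real ^ 'e::finite"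
  assumes "\<And>\<epsilon>. 0 \<le> x $ \<epsilon>" "\<And>\<epsilon>. x $ \<epsilon> = 0 \<Longrightarrow> y $ \<epsilon> \<le> 0"
  obtains \<delta> where "0 < \<delta>" "\<And>\<epsilon>. \<delta> * y $ \<epsilon> \<le> x $ \<epsilon>"
proof -
  \<comment> \<open>The extra \<open>1\<close> keeps the set nonempty when \<open>y\<close> has no
    positive coordinate.\<close>
  let ?M = "insert 1 ((\<lambda>\<epsilon>. x $ \<epsilon> / y $ \<epsilon>) ` {\<epsilon>. 0 < y $ \<epsilon>})"
  have pos: "0 < x $ \<epsilon>" if "0 < y $ \<epsilon>" for \<epsilon>
    using assms[of \<epsilon>] that by (cases "x $ \<epsilon> = 0") auto
  have "0 < Min ?M" using pos by (subst Min_gr_iff) auto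
  moreover have "Min ?M * y $ \<epsilon> \<le> x $ \<epsilon>" for \<epsilon>
  proof (cases "0 < y $ \<epsilon>")
    case True
    then have "Min ?M \<le> x $ \<epsilon> / y $ \<epsilon>" by (intro Min_le) auto
    with True show ?thesis by (simp add: pos_le_divide_eq)
  next
    case False
    then have "Min ?M * y $ \<epsilon> \<le> 0"
      using \<open>0 < Min ?M\<close> by (intro mult_nonneg_nonpos) auto
    then show ?thesis using assms(1)[of \<epsilon>] by linarith
  qed
  ultimately show ?thesis using that by blast
qed

context
  fixes e :: "'e::finite \<Rightarrow> nat \<times> nat" and n :: nat and a :: "nat \<Rightarrow> nat"
  assumes e: "bij_betw e UNIV (K_edges n)"
begin

lemma inj_e: "inj e"
  using e by (rule bij_betw_imp_inj_on)

lemma range_e: "range e = K_edges n"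
  using e by (rule bij_betw_imp_surj_on)

lemma K_edgeE:
  assumes "uv \<in> K_edges n"
  obtains \<epsilon> where "uv = e \<epsilon>"
  using assms range_e by blast

lemma e_less: "fst (e \<epsilon>) < snd (e \<epsilon>)"
  using range_e by (force simp: K_edges_def)

lemma net_inner_edge_function:
  assumes "i \<in> {1..n}"
  shows "net e i \<bullet> (\<chi> \<epsilon>. f (e \<epsilon>)) = (\<Sum>j\<in>{i<..n+1}. f (i, j)) - (\<Sum>k\<in>{1..<i}. f (k, i))"
proof -
  have "net e i \<bullet> (\<chi> \<epsilon>. f (e \<epsilon>)) =
      (\<Sum>\<epsilon>\<in>UNIV. of_bool (fst (e \<epsilon>) = i) * f (e \<epsilon>)) - (\<Sum>\<epsilon>\<in>UNIV. of_bool (snd (e \<epsilon>) = i) * f (e \<epsilon>))"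
    by (simp add: inner_vec_def left_diff_distrib sum_subtractf)
  also have "(\<Sum>\<epsilon>\<in>UNIV. of_bool (fst (e \<epsilon>) = i) * f (e \<epsilon>)) = (\<Sum>uv\<in>K_edges n. of_bool (fst uv = i) * f uv)"
    by (rule sum.reindex_bij_betw[OF e])
  also have "\<dots> = (\<Sum>uv\<in>Pair i ` {i<..n+1}. f uv)"
    using assms by (intro sum.mono_neutral_cong_right finite_K_edges) (auto simp: K_edges_def)
  also have "\<dots> = (\<Sum>j\<in>{i<..n+1}. f (i, j))"
    by (subst sum.reindex) (auto simp: inj_on_def)
  also have "(\<Sum>\<epsilon>\<in>UNIV. of_bool (snd (e \<epsilon>) = i) * f (e \<epsilon>)) = (\<Sum>uv\<in>K_edges n. of_bool (snd uv = i) * f uv)"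
    by (rule sum.reindex_bij_betw[OF e])
  also have "\<dots> = (\<Sum>uv\<in>(\<lambda>k. (k, i)) ` {1..<i}. f uv)"
    using assms by (intro sum.mono_neutral_cong_right finite_K_edges) (auto simp: K_edges_def)
  also have "\<dots> = (\<Sum>k\<in>{1..<i}. f (k, i))"
    by (subst sum.reindex) (auto simp: inj_on_def)
  finally show ?thesis .
qed

lemma edge_function_in_Flow: "(\<chi> \<epsilon>. f (e \<epsilon>)) \<in> Flow e n a \<longleftrightarrow> is_flow n a f"
proof
  assume "(\<chi> \<epsilon>. f (e \<epsilon>)) \<in> Flow e n a"
  then obtain g where g: "is_flow n a g" "(\<chi> \<epsilon>. f (e \<epsilon>)) = (\<chi> \<epsilon>. g (e \<epsilon>))"
    by (auto simp: Flow_def)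
  then have fg: "f uv = g uv" if "uv \<in> K_edges n" for uv
    using that g(2) by (elim K_edgeE) (simp add: vec_eq_iff)
  have "(\<Sum>j\<in>{i<..n+1}. f (i, j)) - (\<Sum>k\<in>{1..<i}. f (k, i)) =
      (\<Sum>j\<in>{i<..n+1}. g (i, j)) - (\<Sum>k\<in>{1..<i}. g (k, i))" if "i \<in> {1..n}" for i
    unfolding net_inner_edge_function[OF that, symmetric] g(2) ..
  then show "is_flow n a f"
    using g(1) by (simp add: is_flow_def fg)
qed (auto simp: Flow_def)

lemma vec_eq_edge_function: "x = (\<chi> \<epsilon>. x $ inv e (e \<epsilon>))"
  by (simp add: vec_eq_iff inv_f_f[OF inj_e])

text \<open>As \<open>e\<close> is a bijection, every vector comes from an edge function, namely
  \<open>\<lambda>uv. x $ inv e uv\<close>, and the flow conditions become conditions on coordinates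
  and inner products.\<close>

lemma Flow_iff:
  "x \<in> Flow e n a \<longleftrightarrow> (\<forall>\<epsilon>. 0 \<le> x $ \<epsilon>) \<and> (\<forall>i\<in>{1..n}. net e i \<bullet> x = real (a i))"
proof -
  let ?f = "\<lambda>uv. x $ inv e uv"
  have x: "x = (\<chi> \<epsilon>. ?f (e \<epsilon>))" by (rule vec_eq_edge_function)
  have "x \<in> Flow e n a \<longleftrightarrow> is_flow n a ?f"
    using edge_function_in_Flow[of ?f] x by simp
  moreover have "(\<forall>uv\<in>K_edges n. 0 \<le> ?f uv) \<longleftrightarrow> (\<forall>\<epsilon>. 0 \<le> x $ \<epsilon>)"
    unfolding range_e[symmetric] by (simp add: inv_f_f[OF inj_e])
  moreover have "net e i \<bullet> x = (\<Sum>j\<in>{i<..n+1}. ?f (i, j)) - (\<Sum>k\<in>{1..<i}. ?f (k, i))" if "i \<in> {1..n}" for i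
    using net_inner_edge_function[OF that, of ?f] x by simp
  ultimately show ?thesis by (simp add: is_flow_def)
qed

lemma supp_subset_iff: "supp e x \<subseteq> H \<longleftrightarrow> (\<forall>\<epsilon>. e \<epsilon> \<notin> H \<longrightarrow> x $ \<epsilon> = 0)"
  by (auto simp: supp_def)

lemma e_in_supp_iff: "e \<epsilon> \<in> supp e x \<longleftrightarrow> x $ \<epsilon> \<noteq> 0"
  using inj_e by (auto simp: supp_def inj_eq)

lemma supp_subset_K_edges: "supp e x \<subseteq> K_edges n"
  using range_e by (auto simp: supp_def)

lemma flow_support_iff_supp: "flow_support n a H \<longleftrightarrow> (\<exists>x\<in>Flow e n a. supp e x = H)"
proof -
  have supp: "supp e (\<chi> \<epsilon>. f (e \<epsilon>)) = {uv\<in>K_edges n. f uv \<noteq> 0}" for f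
    using range_e by (auto simp: supp_def elim!: K_edgeE)
  show ?thesis
  proof
    assume "flow_support n a H"
    then obtain f where "is_flow n a f" "{uv\<in>K_edges n. f uv \<noteq> 0} = H"
      by (rule flow_support_imp_flow)
    then show "\<exists>x\<in>Flow e n a. supp e x = H"
      using edge_function_in_Flow[of f] supp[of f] by auto
  next
    assume "\<exists>x\<in>Flow e n a. supp e x = H"
    then obtain f where f: "is_flow n a f" "supp e (\<chi> \<epsilon>. f (e \<epsilon>)) = H"
      by (auto simp: Flow_def)
    then show "flow_support n a H"
      using is_flow_support[OF f(1)] supp[of f] by simp
  qed
qed

lemma flow_face_iff:
  "x \<in> flow_face e n a H \<longleftrightarrow> (\<forall>\<epsilon>. 0 \<le> x $ \<epsilon>) \<and> (\<forall>i\<in>{1..n}. net e i \<bullet> x = real (a i)) \<and>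
    (\<forall>\<epsilon>. e \<epsilon> \<notin> H \<longrightarrow> x $ \<epsilon> = 0)"
  by (auto simp: flow_face_def Flow_iff supp_subset_iff)

section \<open>Nonempty faces correspond to supports\<close>

lemma convex_flow_face: "convex (flow_face e n a H)"
proof (rule convexI)
  fix x y and u v :: real
  assume *: "x \<in> flow_face e n a H" "y \<in> flow_face e n a H" "0 \<le> u" "0 \<le> v" "u + v = 1"
  have "u * c + v * c = c" for c :: real
    using *(5) by (simp add: distrib_right[symmetric])
  with * show "u *\<^sub>R x + v *\<^sub>R y \<in> flow_face e n a H"
    by (auto simp: flow_face_iff inner_add_right)
qed

text \<open>A combination of nonnegative coordinates with positive weights vanishes only if both do,
  so the ends of an open segment through a point of the face have their supports in \<open>H\<close>
  too.\<close>

lemma flow_face_face_of: "flow_face e n a H face_of Flow e n a"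
  unfolding face_of_def
proof (intro conjI ballI impI)
  show "flow_face e n a H \<subseteq> Flow e n a" by (auto simp: flow_face_def)
  show "convex (flow_face e n a H)" by (rule convex_flow_face)
next
  fix y z x assume yz: "y \<in> Flow e n a" "z \<in> Flow e n a" and x: "x \<in> flow_face e n a H" "x \<in> open_segment y z"
  obtain u where u: "0 < u" "u < 1" "x = (1 - u) *\<^sub>R y + u *\<^sub>R z"
    using x(2) by (auto simp: in_segment)
  have "y $ \<epsilon> = 0 \<and> z $ \<epsilon> = 0" if "e \<epsilon> \<notin> H" for \<epsilon>
  proof -
    have "(1 - u) * y $ \<epsilon> + u * z $ \<epsilon> = 0"
      using x(1) that u(3) by (auto simp: flow_face_iff)
    then show ?thesis
      using yz u by (subst (asm) add_nonneg_eq_0_iff) (auto simp: Flow_iff)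
  qed
  with yz show "y \<in> flow_face e n a H" "z \<in> flow_face e n a H"
    by (auto simp: flow_face_def supp_subset_iff)
qed

text \<open>A point \<open>x\<close> of \<open>F\<close> with the largest support determines
  \<open>F\<close>: its support contains that of every point of \<open>F\<close>, and every flow
  supported there is \<open>x\<close> itself or an end of a segment of flows running through
  \<open>x\<close>.\<close>

lemma face_eq_flow_face:
  assumes F: "F face_of Flow e n a" "F \<noteq> {}"
  obtains x where "x \<in> Flow e n a" "F = flow_face e n a (supp e x)"
proof -
  have FP: "F \<subseteq> Flow e n a" using F(1) by (rule face_of_imp_subset)
  have fin: "finite (supp e x)" for x
    using supp_subset_K_edges finite_K_edges by (rule finite_subset)
  obtain x0 where "x0 \<in> F" using F(2) by auto
  moreover have "\<forall>y. y \<in> F \<longrightarrow> card (supp e y) \<le> card (K_edges n)"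
    using supp_subset_K_edges by (simp add: card_mono)
  ultimately obtain x where x: "x \<in> F" and max: "\<And>y. y \<in> F \<Longrightarrow> card (supp e y) \<le> card (supp e x)"
    using ex_has_greatest_nat[of "\<lambda>y. y \<in> F" x0 "\<lambda>y. card (supp e y)" "Suc (card (K_edges n))"]
    by (auto simp: less_Suc_eq_le)
  have nn: "0 \<le> y $ \<epsilon>" if "y \<in> Flow e n a" for y :: "real ^ 'e" and \<epsilon> using that by (simp add: Flow_iff)
  have "F = flow_face e n a (supp e x)"
  proof (intro equalityI subsetI)
    fix y assume y: "y \<in> F"
    \<comment> \<open>By convexity the midpoint is in \<open>F\<close>. Its support is the union of
      the two supports, so maximality gives the inclusion.\<close>
    define m where "m = midpoint x y"
    have "closed_segment x y \<subseteq> F"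
      using x y F(1) by (intro closed_segment_subset face_of_imp_convex)
    then have "m \<in> F" unfolding m_def by auto
    have "x \<in> Flow e n a" "y \<in> Flow e n a" using x y FP by auto
    then have "m $ \<epsilon> \<noteq> 0 \<longleftrightarrow> x $ \<epsilon> \<noteq> 0 \<or> y $ \<epsilon> \<noteq> 0" for \<epsilon>
      using nn[of x \<epsilon>] nn[of y \<epsilon>] by (simp add: m_def midpoint_def add_nonneg_eq_0_iff)
    then have "supp e m = supp e x \<union> supp e y"
      unfolding supp_def by blast
    then have "supp e m = supp e x"
      using max[OF \<open>m \<in> F\<close>] card_seteq[OF fin[of m], of "supp e x"] by simp
    then show "y \<in> flow_face e n a (supp e x)"
      using \<open>supp e m = supp e x \<union> supp e y\<close> y FP by (auto simp: flow_face_def)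
  next
    fix y assume y: "y \<in> flow_face e n a (supp e x)"
    have xP: "x \<in> Flow e n a" and yP: "y \<in> Flow e n a"
      using x FP y by (auto simp: flow_face_def)
    have "y $ \<epsilon> \<le> 0" if "x $ \<epsilon> = 0" for \<epsilon>
      using y that e_in_supp_iff[of \<epsilon> x] by (simp add: flow_face_iff)
    then obtain \<delta> where \<delta>: "0 < \<delta>" "\<And>\<epsilon>. \<delta> * y $ \<epsilon> \<le> x $ \<epsilon>"
      using pos_multiple_le[of x y] nn[OF xP] by blast
    \<comment> \<open>The segment from \<open>y\<close> to \<open>x\<close> is prolonged slightly
      past \<open>x\<close>; the choice of \<open>\<delta>\<close> keeps \<open>z\<close>
      nonnegative.\<close>
    define z where "z = x + \<delta> *\<^sub>R (x - y)"
    have "0 \<le> z $ \<epsilon>" for \<epsilon>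
    proof -
      have "z $ \<epsilon> = (x $ \<epsilon> - \<delta> * y $ \<epsilon>) + \<delta> * x $ \<epsilon>"
        by (simp add: z_def algebra_simps)
      moreover have "0 \<le> \<delta> * x $ \<epsilon>" using \<delta>(1) nn[OF xP] by simp
      ultimately show ?thesis using \<delta>(2)[of \<epsilon>] by simp
    qed
    moreover have "net e i \<bullet> z = real (a i)" if "i \<in> {1..n}" for i
      using xP yP that by (simp add: z_def inner_add_right inner_diff_right Flow_iff)
    ultimately have zP: "z \<in> Flow e n a" by (simp add: Flow_iff)
    show "y \<in> F"
    proof (cases "y = x")
      case False
      \<comment> \<open>The weight \<open>1 / (1 + \<delta>)\<close> places \<open>x\<close>
        strictly between \<open>y\<close> and \<open>z\<close>.\<close>
      have "x = (1 - 1 / (1 + \<delta>)) *\<^sub>R y + (1 / (1 + \<delta>)) *\<^sub>R z"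
      proof -
        have "(1 - t) *\<^sub>R y + t *\<^sub>R z = y + (t * (1 + \<delta>)) *\<^sub>R (x - y)" for t
          by (simp add: z_def algebra_simps)
        moreover have "1 / (1 + \<delta>) * (1 + \<delta>) = 1" using \<delta>(1) by simp
        ultimately show ?thesis by simp
      qed
      moreover have "0 < 1 / (1 + \<delta>)" "1 / (1 + \<delta>) < 1" using \<delta>(1) by auto
      moreover have "y \<noteq> z"
      proof
        assume "y = z"
        then have "(1 + \<delta>) *\<^sub>R (x - y) = 0" by (simp add: z_def algebra_simps)
        with \<delta>(1) False show False by simp
      qed
      ultimately have "x \<in> open_segment y z" unfolding in_segment by blast
      with F(1) yP zP x show ?thesis by (blast dest: face_ofD)
    qed (use x in simp)
  qed
  with x FP that show ?thesis by blast
qed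

section \<open>The dimension of a face\<close>

text \<open>The balance equations are imposed one vertex at a time. Increasing a single outgoing edge of
  vertex \<open>m + 1\<close> violates its equation but none of the earlier ones, so each vertex
  with an outgoing edge lowers the dimension by exactly one.\<close>

definition partial_flows :: "(nat \<times> nat) set \<Rightarrow> nat \<Rightarrow> (real ^ 'e) set" where
  "partial_flows H m = {y. (\<forall>\<epsilon>. e \<epsilon> \<notin> H \<longrightarrow> y $ \<epsilon> = 0) \<and> (\<forall>i\<in>{1..m}. net e i \<bullet> y = real (a i))}"

lemma affine_partial_flows: "affine (partial_flows H m)"
  unfolding affine_def
proof (intro ballI allI impI)
  fix x y and u v :: real
  assume *: "x \<in> partial_flows H m" "y \<in> partial_flows H m" "u + v = 1"
  have "u * c + v * c = c" for c :: real
    using *(3) by (simp add: distrib_right[symmetric])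
  with * show "u *\<^sub>R x + v *\<^sub>R y \<in> partial_flows H m"
    by (auto simp: partial_flows_def inner_add_right)
qed

text \<open>Without balance equations this is the coordinate subspace spanned by the axes of the
  edges in \<open>H\<close>.\<close>

lemma aff_dim_partial_flows_0:
  assumes "H \<subseteq> K_edges n"
  shows "aff_dim (partial_flows H 0) = int (card H)"
proof -
  define E where "E = {\<epsilon>. e \<epsilon> \<in> H}"
  define d where "d = (\<lambda>\<epsilon>. axis \<epsilon> (1::real)) ` E"
  have "d \<subseteq> Basis" by (auto simp: d_def Basis_vec_def)
  have "partial_flows H 0 = {y. \<forall>b\<in>Basis. b \<notin> d \<longrightarrow> y \<bullet> b = 0}"
    by (auto simp: partial_flows_def Basis_vec_def d_def E_def inner_axis image_iff axis_eq_axis)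
  moreover from this have "subspace (partial_flows H 0)"
    by (auto simp: subspace_def inner_add_left)
  ultimately have "aff_dim (partial_flows H 0) = int (card d)"
    using dim_substandard[OF \<open>d \<subseteq> Basis\<close>] by (simp add: aff_dim_subspace)
  also have "card d = card E"
    unfolding d_def by (intro card_image) (auto simp: inj_on_def axis_eq_axis)
  also have "card E = card (e ` E)"
    using inj_e by (intro card_image[symmetric]) (auto intro: inj_on_subset)
  also have "e ` E = H"
    using assms range_e by (simp add: E_def vimage_def[symmetric] Int_absorb2)
  finally show ?thesis .
qed

lemma aff_dim_partial_flows:
  assumes x: "x \<in> Flow e n a" "supp e x = H" and "m \<le> n"
  shows "aff_dim (partial_flows H m) = int (card H) - int (card (fst ` H \<inter> {1..m}))"
  using assms(3)
proof (induction m)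
  case 0
  then show ?case using aff_dim_partial_flows_0 x(2) supp_subset_K_edges by auto
next
  case (Suc m)
  let ?h = "{y. net e (Suc m) \<bullet> y = real (a (Suc m))}"
  have xL: "x \<in> partial_flows H k" if "k \<le> n" for k
    using x that by (auto simp: partial_flows_def Flow_iff e_in_supp_iff)
  have L: "partial_flows H (Suc m) = partial_flows H m \<inter> ?h"
    by (auto simp: partial_flows_def atLeastAtMostSuc_conv)
  \<comment> \<open>The flow \<open>x\<close> satisfies all the equations, so the next hyperplane
    does meet the affine set, and the dimension drops by at most one.\<close>
  have ne: "partial_flows H m \<inter> ?h \<noteq> {}"
    using xL[OF Suc.prems] L by auto
  have supp: "flow_support n a H" using x flow_support_iff_supp by auto
  show ?case
  proof (cases "Suc m \<in> fst ` H")
    case True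
    then obtain \<epsilon> where \<epsilon>: "e \<epsilon> \<in> H" "fst (e \<epsilon>) = Suc m"
      using x(2) unfolding supp_def by force
    have less: "Suc m < snd (e \<epsilon>)" using e_less[of \<epsilon>] \<epsilon>(2) by simp
    have "(x + axis \<epsilon> 1) $ \<epsilon>' = 0" if "e \<epsilon>' \<notin> H" for \<epsilon>'
      using xL[of m] Suc.prems \<epsilon>(1) that by (auto simp: partial_flows_def axis_def)
    \<comment> \<open>Both ends of the edge \<open>e \<epsilon>\<close> lie beyond \<open>m\<close>,
      so its axis is orthogonal to the earlier normal vectors.\<close>
    moreover have "net e i \<bullet> (x + axis \<epsilon> 1) = real (a i)" if "i \<in> {1..m}" for i
      using xL[of m] Suc.prems \<epsilon> less that by (auto simp: partial_flows_def inner_add_right inner_axis)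
    ultimately have "x + axis \<epsilon> 1 \<in> partial_flows H m"
      by (simp add: partial_flows_def)
    moreover have "x + axis \<epsilon> 1 \<notin> ?h"
      using xL[OF Suc.prems] \<epsilon> less by (auto simp: partial_flows_def inner_add_right inner_axis)
    ultimately have "aff_dim (partial_flows H (Suc m)) = aff_dim (partial_flows H m) - 1"
      unfolding L aff_dim_affine_Int_hyperplane[OF affine_partial_flows] using ne by auto
    moreover have "fst ` H \<inter> {1..Suc m} = insert (Suc m) (fst ` H \<inter> {1..m})"
      using True by auto
    ultimately show ?thesis using Suc by simp
  next
    case False
    \<comment> \<open>A vertex without outgoing edges is not fed either, so no edge of
      \<open>H\<close> touches it and its balance equation reads \<open>0 = 0\<close>.\<close>
    have "a (Suc m) = 0" "Suc m \<notin> snd ` H"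
      using supp False Suc.prems by (auto simp: flow_support_def)
    have "net e (Suc m) \<bullet> y = 0" if "y \<in> partial_flows H m" for y
    proof -
      have "net e (Suc m) $ \<epsilon> * y $ \<epsilon> = 0" for \<epsilon>
      proof (cases "e \<epsilon> \<in> H")
        case True
        then have "fst (e \<epsilon>) \<noteq> Suc m" "snd (e \<epsilon>) \<noteq> Suc m"
          using False \<open>Suc m \<notin> snd ` H\<close> by (metis imageI)+
        then show ?thesis by simp
      qed (use that in \<open>simp add: partial_flows_def\<close>)
      then show ?thesis unfolding inner_vec_def inner_real_def by (intro sum.neutral ballI)
    qed
    then have "partial_flows H (Suc m) = partial_flows H m"
      using L \<open>a (Suc m) = 0\<close> by auto
    moreover have "fst ` H \<inter> {1..Suc m} = fst ` H \<inter> {1..m}"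
      using False by (simp add: atLeastAtMostSuc_conv)
    ultimately show ?thesis using Suc by simp
  qed
qed

text \<open>The face contains those points of the affine space \<open>partial_flows H n\<close> that
  are positive on \<open>H\<close>. They form a nonempty relatively open subset, so the face has the
  dimension of that space.\<close>

lemma aff_dim_flow_face:
  assumes "flow_support n a H"
  shows "aff_dim (flow_face e n a H) = int (card H) - int (card (fst ` H))"
proof -
  obtain x where x: "x \<in> Flow e n a" "supp e x = H"
    using assms flow_support_iff_supp by auto
  let ?L = "partial_flows H n"
  define U where "U = (\<Inter>\<epsilon>\<in>{\<epsilon>. e \<epsilon> \<in> H}. {y :: real ^ 'e. 0 < y $ \<epsilon>})"
  have "open U"
    unfolding U_def by (intro open_INT ballI finite open_Collect_less continuous_intros)
  moreover have "?L \<inter> U \<noteq> {}"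
  proof -
    have "0 < x $ \<epsilon>" if "e \<epsilon> \<in> H" for \<epsilon>
      using x that e_in_supp_iff[of \<epsilon> x] by (auto simp: Flow_iff less_le)
    then have "x \<in> ?L \<inter> U"
      using x by (auto simp: partial_flows_def U_def Flow_iff e_in_supp_iff)
    then show ?thesis by blast
  qed
  ultimately have "aff_dim (?L \<inter> U) = aff_dim ?L"
    using affine_partial_flows affine_imp_convex by (intro aff_dim_convex_Int_open) auto
  moreover have "?L \<inter> U \<subseteq> flow_face e n a H"
  proof
    fix y assume y: "y \<in> ?L \<inter> U"
    then have "0 \<le> y $ \<epsilon>" for \<epsilon>
      by (cases "e \<epsilon> \<in> H") (auto simp: partial_flows_def U_def intro: less_imp_le)
    with y show "y \<in> flow_face e n a H" by (simp add: flow_face_iff partial_flows_def)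
  qed
  moreover have "flow_face e n a H \<subseteq> ?L"
    by (auto simp: flow_face_iff partial_flows_def)
  ultimately have "aff_dim (flow_face e n a H) = aff_dim ?L"
    using aff_dim_subset by (metis order_antisym)
  moreover have "fst ` H \<inter> {1..n} = fst ` H"
    using assms by (auto simp: flow_support_def K_edges_def)
  ultimately show ?thesis using aff_dim_partial_flows[OF x] by simp
qed

text \<open>The face of \<open>H\<close> contains a flow with support exactly \<open>H\<close>, so
  \<open>H\<close> can be recovered from it.\<close>

lemma inj_on_flow_face: "inj_on (flow_face e n a) {H. flow_support n a H}"
proof -
  have "H \<subseteq> H'" if H: "flow_support n a H" "flow_face e n a H = flow_face e n a H'" for H H'
  proof -
    obtain x where "x \<in> Flow e n a" "supp e x = H"
      using H(1)[unfolded flow_support_iff_supp] by blast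
    with H(2) show ?thesis by (auto simp: flow_face_def)
  qed
  then show ?thesis by (auto simp: inj_on_def)
qed

lemma faces_of_Flow: "{F. F face_of Flow e n a} = insert {} (flow_face e n a ` {H. flow_support n a H})"
proof (intro equalityI subsetI)
  fix F assume F: "F \<in> {F. F face_of Flow e n a}"
  show "F \<in> insert {} (flow_face e n a ` {H. flow_support n a H})"
  proof (cases "F = {}")
    case False
    with F obtain x where "x \<in> Flow e n a" "F = flow_face e n a (supp e x)"
      using face_eq_flow_face by blast
    then show ?thesis using flow_support_iff_supp by blast
  qed simp
qed (auto simp: flow_face_face_of)

lemma flow_face_nonempty: "flow_support n a H \<Longrightarrow> flow_face e n a H \<noteq> {}"
  using flow_support_iff_supp by (auto simp: flow_face_def)

end

section \<open>The f-polynomial as a sum over supports\<close>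

text \<open>The faces are grouped by dimension; every \<open>aff_dim\<close> lies in the range of
  the sum defining \<open>f_polynomial\<close>.\<close>

lemma f_polynomial_eq_sum_faces:
  fixes P :: "'a::euclidean_space set"
  assumes "finite {F. F face_of P}"
  shows "f_polynomial P = (\<Sum>F | F face_of P. fls_X powi aff_dim F)"
proof -
  have "(\<Sum>F | F face_of P. fls_X powi aff_dim F) =
      (\<Sum>d\<in>{-1..int DIM('a)}. \<Sum>F | F \<in> {F. F face_of P} \<and> aff_dim F = d. fls_X powi aff_dim F :: rat fls)"
    using assms aff_dim_geq aff_dim_le_DIM by (intro sum.group[symmetric]) auto
  also have "\<dots> = f_polynomial P"
    unfolding f_polynomial_def face_number_def by (intro sum.cong refl) simp
  finally show ?thesis ..
qed

lemma f_polynomial_Flow: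
  fixes e :: "'e::finite \<Rightarrow> nat \<times> nat"
  assumes e: "bij_betw e UNIV (K_edges n)"
  shows "f_polynomial (Flow e n a) =
    1 / fls_X + (\<Sum>H | flow_support n a H. fls_X ^ card H / fls_X ^ card (fst ` H))"
proof -
  let ?S = "{H. flow_support n a H}"
  have fin: "finite ?S"
    by (rule finite_subset[of _ "Pow (K_edges n)"]) (auto simp: flow_support_def)
  have "f_polynomial (Flow e n a) = (\<Sum>F\<in>insert {} (flow_face e n a ` ?S). fls_X powi aff_dim F)"
    using fin by (subst f_polynomial_eq_sum_faces) (simp_all add: faces_of_Flow[OF e])
  \<comment> \<open>The empty face has dimension \<open>-1\<close> and differs from all the faces
    given by supports.\<close>
  also have "\<dots> = 1 / fls_X + (\<Sum>F\<in>flow_face e n a ` ?S. fls_X powi aff_dim F)"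
    using fin flow_face_nonempty[OF e] by (subst sum.insert) (auto simp: power_int_minus divide_inverse)
  also have "(\<Sum>F\<in>flow_face e n a ` ?S. fls_X powi aff_dim F) =
      (\<Sum>H\<in>?S. fls_X powi aff_dim (flow_face e n a H) :: rat fls)"
    by (subst sum.reindex[OF inj_on_flow_face[OF e]]) simp
  also have "\<dots> = (\<Sum>H\<in>?S. fls_X ^ card H / fls_X ^ card (fst ` H))"
  proof (intro sum.cong refl)
    fix H assume "H \<in> ?S"
    then have "aff_dim (flow_face e n a H) = int (card H) - int (card (fst ` H))"
      using aff_dim_flow_face[OF e] by simp
    then show "fls_X powi aff_dim (flow_face e n a H) = (fls_X ^ card H / fls_X ^ card (fst ` H) :: rat fls)"
      by (simp only: power_int_diff[OF disjI1[OF fls_X_nonzero]] power_int_of_nat)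
  qed
  finally show ?thesis .
qed

theorem theorem3p14:
  fixes n :: nat and a :: "nat \<Rightarrow> nat" and e :: "'e::finite \<Rightarrow> nat \<times> nat"
  assumes "1 \<le> n"
    and "a 1 \<noteq> 0"
    and "bij_betw e UNIV (K_edges n)"
  shows "f_polynomial (Flow e n a) =
    Q_poly (revcomp n a) fls_X (\<lambda>i. (fls_X + 1) ^ i - (fls_X + 1))"
  unfolding f_polynomial_Flow[OF assms(3)]
  \<comment> \<open>\<open>fls_X\<close> is a nonzero element of the field of formal Laurent series,
    so the field identity applies with \<open>x = fls_X\<close>.\<close>
  by (rule sum_flow_supports_eq_Q_poly) (use assms in simp_all)

end
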